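(* Let $n\ge1$ and $w\in S_n$. Then \[ \overleftarrow{\mathfrak{G}}_w(x_i \mapsto q^{i-1}) = \sum_{a \in \mathsf{Hecke}(w)} \frac{\beta^{\ell(a)-\ell(w)}}{(q-1)(q^{2}-1)\cdots (q^{\ell(a)}-1)}\,q^{\sum a+\operatorname{comaj}(a)}, \] where each summand on the right is expanded as a Laurent series in $q^{-1}$.
   Context: Let $x_i$ ($i\in\mathbb{Z}$) be commuting indeterminates and $\beta$ an indeterminate. Let $s_i=(i,i+1)$, $S_n=\langle s_1,\dots,s_{n-1}\rangle$, $\overleftarrow{S}_n=\langle s_i:i<n\rangle$, with Coxeter length $\ell$. For $w\in\overleftarrow{S}_n$, $\mathsf{Hecke}(w)$ is the set of words $a_1\cdots a_N$ with integer letters $<n$ whose Demazure product is $w$, i.e. such that $\pi_{s_{a_1}}\cdots\pi_{s_{a_N}}=\beta^{N-\ell(w)}\pi_w$ in the id-Coxeter algebra over $\mathbb{Z}[\beta]$ (basis $\pi_v$, relations $\pi_u\pi_v=\pi_{uv}$ when $\ell(uv)=\ell(u)+\ell(v)$ and $\pi_s^2=\beta\pi_s$ for simple $s$). For a word $a=a_1\cdots a_p$, $\ell(a)=p$, $\sum a=\sum_i a_i$, $\operatorname{comaj}(a)=\sum_{i:\,a_i<a_{i+1}}i$; a bounded compatible sequence for $a$ is a weakly increasing integer sequence $\mathbf{i}=(i_1\le\dots\le i_p)$ with $i_j<i_{j+1}$ whenever $a_j\le a_{j+1}$ and $i_j\le a_j$ whenever $0<i_j$; $\mathsf{Compatible}(a)$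 is the set of these, $\ell(\mathbf{i})=p$, $x_{\mathbf{i}}=x_{i_1}\cdots x_{i_p}$. The backstable Grothendieck polynomial is $\overleftarrow{\mathfrak{G}}_w=\sum_{a\in\mathsf{Hecke}(w)}\sum_{\mathbf{i}\in\mathsf{Compatible}(a)}\beta^{\ell(\mathbf{i})-\ell(w)}x_{\mathbf{i}}\in\mathbb{Z}[\beta][[\dots,x_{-1},x_0,\dots,x_{n-1}]]$. $F(x_i\mapsto q^{i-1})$ denotes setting $x_i=q^{i-1}$ for all integers $i<n$, yielding a Laurent series in $q^{-1}$ (with coefficients in $\mathbb{Z}[\beta]$). *)

theory Defs
  imports
    "HOL-Analysis.Infinite_Sum"
    "HOL-Computational_Algebra.Formal_Laurent_Series"
    "HOL-Computational_Algebra.Polynomial"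
    "HOL-Combinatorics.Perm"
    "HOL-Combinatorics.Multiset_Permutations"
    "HOL-Library.Poly_Mapping"
begin

section \<open>The Coxeter group of finitely supported permutations of the integers\<close>

notation "Perm.apply" (infixl "\<langle>$\<rangle>" 999)

definition simple :: "int \<Rightarrow> int perm" where
  "simple i = Perm.swap i (i + 1)"

text \<open>
  The subgroup generated by the \<open>simple i\<close> with \<open>i \<in> I\<close>; as the generators are involutions,
  it is the submonoid generated by them.
\<close>
definition simple_subgroup :: "int set \<Rightarrow> int perm set" where
  "simple_subgroup I = {prod_list (map simple a) | a. set a \<subseteq> I}"

definition cox_length :: "int perm \<Rightarrow> nat" where
  "cox_length w = (LEAST k. \<exists>a. length a = k \<and> prod_list (map simple a) = w)"

subsection \<open>Length and inversions\<close>

lemma apply_simple: "simple i \<langle>$\<rangle> x = (if x = i then i + 1 else if x = i + 1 then i else x)"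
  by (auto simp: simple_def)

lemma simple_simple [simp]: "simple i * simple i = 1"
  by (simp add: simple_def)

lemma mult_simple_simple [simp]: "w * simple i * simple i = w"
  by (simp add: mult.assoc)

lemma simple_mult_simple [simp]: "simple i * (simple i * w) = w"
  by (simp flip: mult.assoc)

lemma inverse_simple [simp]: "inverse (simple i) = simple i"
  by (simp add: simple_def)

lemma apply_inverse_apply [simp]: "w \<langle>$\<rangle> (inverse w \<langle>$\<rangle> x) = x" for w :: "int perm"
  by (simp add: apply_sequence)

lemma apply_apply_inverse [simp]: "inverse w \<langle>$\<rangle> (w \<langle>$\<rangle> x) = x" for w :: "int perm"
  by (simp add: apply_sequence)

lemma inverse_apply_eq_iff: "inverse w \<langle>$\<rangle> x = y \<longleftrightarrow> x = w \<langle>$\<rangle> y" for w :: "int perm"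
  by auto

definition inversions :: "int perm \<Rightarrow> (int \<times> int) set" where
  "inversions w = {(a, b). a < b \<and> w \<langle>$\<rangle> b < w \<langle>$\<rangle> a}"

lemma inversions_1 [simp]: "inversions 1 = {}"
  by (auto simp: inversions_def)

lemma perm_bound:
  fixes w :: "int perm"
  obtains M where "M \<ge> 0" "\<And>x. \<bar>x\<bar> > M \<Longrightarrow> w \<langle>$\<rangle> x = x" "\<And>x. \<bar>x\<bar> \<le> M \<Longrightarrow> \<bar>w \<langle>$\<rangle> x\<bar> \<le> M"
proof -
  define M where "M = Max (insert 0 (abs ` affected w))"
  have fin: "finite (insert 0 (abs ` affected w))" by simp
  have 1: "w \<langle>$\<rangle> x = x" if "\<bar>x\<bar> > M" for x
  proof (rule ccontr)
    assume "w \<langle>$\<rangle> x \<noteq> x"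
    then have "\<bar>x\<bar> \<in> insert 0 (abs ` affected w)" by (simp add: in_affected)
    then have "\<bar>x\<bar> \<le> M" unfolding M_def using Max_ge[OF fin] by blast
    with that show False by simp
  qed
  have 2: "\<bar>w \<langle>$\<rangle> x\<bar> \<le> M" if "\<bar>x\<bar> \<le> M" for x
  proof (rule ccontr)
    assume "\<not> ?thesis"
    then have "w \<langle>$\<rangle> (w \<langle>$\<rangle> x) = w \<langle>$\<rangle> x" using 1[of "w \<langle>$\<rangle> x"] by simp
    then have "w \<langle>$\<rangle> x = x" by (simp add: apply_inj)
    with that \<open>\<not> ?thesis\<close> show False by simp
  qed
  have "M \<ge> 0" unfolding M_def using Max_ge[OF fin] by blast
  with 1 2 that show ?thesis by blast
qed

lemma finite_inversions [simp]: "finite (inversions w)"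
proof -
  obtain M where M: "M \<ge> 0" "\<And>x. \<bar>x\<bar> > M \<Longrightarrow> w \<langle>$\<rangle> x = x" "\<And>x. \<bar>x\<bar> \<le> M \<Longrightarrow> \<bar>w \<langle>$\<rangle> x\<bar> \<le> M"
    using perm_bound[of w] by blast
  have "inversions w \<subseteq> {-M..M} \<times> {-M..M}"
  proof (clarsimp simp: inversions_def)
    fix a b assume ab: "a < b" "w \<langle>$\<rangle> b < w \<langle>$\<rangle> a"
    have "\<bar>a\<bar> \<le> M \<and> \<bar>b\<bar> \<le> M"
      using ab M(2)[of a] M(2)[of b] M(3)[of a] M(3)[of b] by linarith
    then show "-M \<le> a \<and> a \<le> M \<and> -M \<le> b \<and> b \<le> M" by linarith
  qed
  then show ?thesis by (rule finite_subset) simp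
qed

lemma inversions_mult_simple:
  assumes "w \<langle>$\<rangle> i < w \<langle>$\<rangle> (i + 1)"
  shows "card (inversions (w * simple i)) = Suc (card (inversions w))"
proof -
  define f where "f = (\<lambda>p. (simple i \<langle>$\<rangle> (fst p), simple i \<langle>$\<rangle> (snd p)))"
  have inj: "inj_on f (inversions w)"
    by (auto simp: inj_on_def f_def apply_inj)
  have mono: "simple i \<langle>$\<rangle> a < simple i \<langle>$\<rangle> b" if "a < b" "(a, b) \<noteq> (i, i + 1)" for a b
    using that by (auto simp: apply_simple)
  have ss: "simple i \<langle>$\<rangle> (simple i \<langle>$\<rangle> x) = x" for x
    by (simp add: apply_sequence)
  have eq: "inversions (w * simple i) = insert (i, i + 1) (f ` inversions w)"
  proof (intro subset_antisym subsetI)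
    fix p assume p: "p \<in> inversions (w * simple i)"
    obtain a b where ab: "p = (a, b)" by (cases p)
    show "p \<in> insert (i, i + 1) (f ` inversions w)"
    proof (cases "(a, b) = (i, i + 1)")
      case False
      then have "f p \<in> inversions w"
        using p mono[of a b] by (simp add: inversions_def f_def ab apply_times)
      moreover have "f (f p) = p" by (simp add: ab f_def ss)
      ultimately show ?thesis by (metis imageI insertI2)
    qed (simp add: ab)
  next
    fix p assume "p \<in> insert (i, i + 1) (f ` inversions w)"
    then consider "p = (i, i + 1)" | a b where "p = f (a, b)" "(a, b) \<in> inversions w" by auto
    then show "p \<in> inversions (w * simple i)"
    proof cases
      case 1
      then show ?thesis using assms by (simp add: inversions_def apply_times apply_simple)
    next
      case 2
      then have "(a, b) \<noteq> (i, i + 1)" using assms by (auto simp: inversions_def)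
      with 2 show ?thesis using mono[of a b] by (simp add: inversions_def f_def apply_times ss)
    qed
  qed
  have "(i, i + 1) \<notin> f ` inversions w"
    using assms by (auto simp: inversions_def f_def apply_simple split: if_splits)
  then show ?thesis by (simp add: eq card_image[OF inj])
qed

lemma inversions_mult_simple':
  assumes "w \<langle>$\<rangle> (i + 1) < w \<langle>$\<rangle> i"
  shows "card (inversions w) = Suc (card (inversions (w * simple i)))"
  using inversions_mult_simple[of "w * simple i" i] assms
  by (simp add: apply_times apply_simple)

lemma apply_neq_Suc: "w \<langle>$\<rangle> i \<noteq> w \<langle>$\<rangle> (i + 1)" for w :: "int perm"
  by (simp add: apply_inj)

lemma ascending_imp_one:
  assumes asc: "\<And>i. w \<langle>$\<rangle> i < w \<langle>$\<rangle> (i + 1)"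
  shows "w = (1 :: int perm)"
proof -
  obtain M where M: "M \<ge> 0" "\<And>x. \<bar>x\<bar> > M \<Longrightarrow> w \<langle>$\<rangle> x = x" "\<And>x. \<bar>x\<bar> \<le> M \<Longrightarrow> \<bar>w \<langle>$\<rangle> x\<bar> \<le> M"
    using perm_bound[of w] by blast
  have up: "w \<langle>$\<rangle> x + int k \<le> w \<langle>$\<rangle> (x + int k)" for x k
  proof (induction k)
    case (Suc k)
    have "x + int (Suc k) = x + int k + 1" by simp
    then show ?case using Suc asc[of "x + int k"] by (simp only:)
  qed simp
  show ?thesis
  proof (rule perm_eqI)
    fix x
    have "w \<langle>$\<rangle> (x + int (nat (\<bar>x\<bar> + M + 1 + \<bar>x\<bar>))) = x + int (nat (\<bar>x\<bar> + M + 1 + \<bar>x\<bar>))"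
      using M(1) by (intro M(2)) auto
    moreover have "w \<langle>$\<rangle> (x - int (nat (\<bar>x\<bar> + M + 1 + \<bar>x\<bar>))) = x - int (nat (\<bar>x\<bar> + M + 1 + \<bar>x\<bar>))"
      using M(1) by (intro M(2)) auto
    ultimately show "w \<langle>$\<rangle> x = 1 \<langle>$\<rangle> x"
      using up[of x "nat (\<bar>x\<bar> + M + 1 + \<bar>x\<bar>)"]
        up[of "x - int (nat (\<bar>x\<bar> + M + 1 + \<bar>x\<bar>))" "nat (\<bar>x\<bar> + M + 1 + \<bar>x\<bar>)"] by simp
  qed
qed

lemma ex_word_inversions:
  "\<exists>a. length a = card (inversions w) \<and> prod_list (map simple a) = w"
proof (induction "card (inversions w)" arbitrary: w)
  case 0
  have "w = 1"
  proof (rule ascending_imp_one)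
    fix i
    have "\<not> w \<langle>$\<rangle> (i + 1) < w \<langle>$\<rangle> i" using inversions_mult_simple'[of w i] 0 by auto
    then show "w \<langle>$\<rangle> i < w \<langle>$\<rangle> (i + 1)" using apply_neq_Suc[of w i] by linarith
  qed
  then show ?case using 0 by (intro exI[of _ "[]"]) simp
next
  case (Suc k)
  have "\<exists>i. w \<langle>$\<rangle> (i + 1) < w \<langle>$\<rangle> i"
  proof (rule ccontr)
    assume "\<not> ?thesis"
    then have "w = 1" using ascending_imp_one[of w] apply_neq_Suc[of w] by (meson linorder_less_linear)
    with Suc(2) show False by simp
  qed
  then obtain i where i: "w \<langle>$\<rangle> (i + 1) < w \<langle>$\<rangle> i" by blast
  then obtain a where "length a = k" "prod_list (map simple a) = w * simple i"
    using Suc inversions_mult_simple'[OF i] by (metis Suc_inject)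
  then show ?case using Suc(2) by (intro exI[of _ "a @ [i]"]) simp
qed

lemma inversions_prod_list: "card (inversions (prod_list (map simple a))) \<le> length a"
proof (induction a rule: rev_induct)
  case Nil
  then show ?case by simp
next
  case (snoc i a)
  let ?w = "prod_list (map simple a)"
  show ?case
    using snoc inversions_mult_simple[of ?w i] inversions_mult_simple'[of ?w i] apply_neq_Suc[of ?w i]
    by (cases "?w \<langle>$\<rangle> i < ?w \<langle>$\<rangle> (i + 1)") auto
qed

lemma cox_length_eq: "cox_length w = card (inversions w)"
  unfolding cox_length_def
  by (rule Least_equality) (use ex_word_inversions inversions_prod_list in auto)

lemma cox_length_1 [simp]: "cox_length 1 = 0"
  by (simp add: cox_length_eq)

lemma cox_length_prod_list_le: "cox_length (prod_list (map simple a)) \<le> length a"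
  by (simp add: cox_length_eq inversions_prod_list)

lemma ex_reduced_word: "\<exists>a. length a = cox_length w \<and> prod_list (map simple a) = w"
  by (simp add: cox_length_eq ex_word_inversions)

lemma cox_length_mult_simple:
  "cox_length (w * simple i) = (if w \<langle>$\<rangle> i < w \<langle>$\<rangle> (i + 1) then cox_length w + 1 else cox_length w - 1)"
  using inversions_mult_simple[of w i] inversions_mult_simple'[of w i] apply_neq_Suc[of w i]
  by (auto simp: cox_length_eq)

lemma ascent_iff: "cox_length w < cox_length (w * simple i) \<longleftrightarrow> w \<langle>$\<rangle> i < w \<langle>$\<rangle> (i + 1)"
  using cox_length_mult_simple[of w i] by auto

lemma inverse_prod_list_simple:
  "inverse (prod_list (map simple a)) = prod_list (map simple (rev a))"
  by (induction a) simp_all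

lemma cox_length_inverse_le: "cox_length (inverse w) \<le> cox_length w"
proof -
  obtain a where "length a = cox_length w" "prod_list (map simple a) = w"
    using ex_reduced_word by blast
  then show ?thesis using cox_length_prod_list_le[of "rev a"]
    by (simp flip: inverse_prod_list_simple)
qed

lemma cox_length_inverse [simp]: "cox_length (inverse w) = cox_length w"
  using cox_length_inverse_le[of w] cox_length_inverse_le[of "inverse w"] by simp

lemma left_ascent_iff:
  "cox_length w < cox_length (simple i * w) \<longleftrightarrow> inverse w \<langle>$\<rangle> i < inverse w \<langle>$\<rangle> (i + 1)"
  using ascent_iff[of "inverse w" i] cox_length_inverse[of "simple i * w"] by simp


section \<open>The id-Coxeter algebra\<close>

abbreviation \<beta> :: "int poly" where
  "\<beta> \<equiv> [:0, 1:]"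

locale id_coxeter_algebra = module scale
  for scale :: "int poly \<Rightarrow> 'a::ring_1 \<Rightarrow> 'a" +
  fixes b :: "int perm \<Rightarrow> 'a"
  assumes scale_mult_left: "scale c x * y = scale c (x * y)"
    and scale_mult_right: "x * scale c y = scale c (x * y)"
    and basis_inj: "inj b"
    and basis_independent: "independent (range b)"
    and basis_span: "span (range b) = UNIV"
    and basis_mult: "cox_length (u * v) = cox_length u + cox_length v \<Longrightarrow> b u * b v = b (u * v)"
    and basis_square: "b (simple i) * b (simple i) = scale \<beta> (b (simple i))"

text \<open>
  Such an algebra is unique up to isomorphism. We construct it on the free module over
  \<open>int poly\<close> with basis all of \<open>int perm\<close>; the product with a basis element on the right
  (on the left) is computed one simple factor at a time.
\<close>

type_synonym idc_module = "int perm \<Rightarrow>\<^sub>0 int poly"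

definition sc :: "int poly \<Rightarrow> idc_module \<Rightarrow> idc_module" where
  "sc c x = Poly_Mapping.map ((*) c) x"

abbreviation bvec :: "int perm \<Rightarrow> idc_module" where
  "bvec u \<equiv> Poly_Mapping.single u 1"

definition lin :: "(int perm \<Rightarrow> idc_module) \<Rightarrow> idc_module \<Rightarrow> idc_module" where
  "lin f x = (\<Sum>u\<in>Poly_Mapping.keys x. sc (Poly_Mapping.lookup x u) (f u))"

definition right_simple :: "int \<Rightarrow> idc_module \<Rightarrow> idc_module" where
  "right_simple i = lin (\<lambda>u.
     if cox_length u < cox_length (u * simple i) then bvec (u * simple i) else sc \<beta> (bvec u))"

definition reduced_word :: "int perm \<Rightarrow> int list" where
  "reduced_word v = (SOME a. length a = cox_length v \<and> prod_list (map simple a) = v)"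

definition idc_mult :: "idc_module \<Rightarrow> idc_module \<Rightarrow> idc_module" where
  "idc_mult x y = lin (\<lambda>v. fold right_simple (reduced_word v) x) y"

subsection \<open>Linearity\<close>

lemma lookup_sc [simp]: "Poly_Mapping.lookup (sc c x) u = c * Poly_Mapping.lookup x u"
  by (simp add: sc_def Poly_Mapping.map.rep_eq when_def)

lemma sc_add: "sc c (x + y) = sc c x + sc c y"
  by (rule poly_mapping_eqI) (simp add: lookup_add algebra_simps)

lemma sc_add_left: "sc (c + d) x = sc c x + sc d x"
  by (rule poly_mapping_eqI) (simp add: lookup_add algebra_simps)

lemma sc_sc [simp]: "sc c (sc d x) = sc (c * d) x"
  by (rule poly_mapping_eqI) (simp add: algebra_simps)

lemma sc_one [simp]: "sc 1 x = x"
  by (rule poly_mapping_eqI) simp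

lemma sc_zero [simp]: "sc 0 x = 0" "sc c 0 = 0"
  by (rule poly_mapping_eqI; simp)+

lemma sc_sum: "sc c (sum f A) = (\<Sum>a\<in>A. sc c (f a))"
  by (induction A rule: infinite_finite_induct) (simp_all add: sc_add)

definition is_lin :: "(idc_module \<Rightarrow> idc_module) \<Rightarrow> bool" where
  "is_lin T \<longleftrightarrow> (\<forall>x y. T (x + y) = T x + T y) \<and> (\<forall>c x. T (sc c x) = sc c (T x))"

lemma is_lin_add: "is_lin T \<Longrightarrow> T (x + y) = T x + T y"
  and is_lin_sc: "is_lin T \<Longrightarrow> T (sc c x) = sc c (T x)"
  by (auto simp: is_lin_def)

lemma is_lin_zero: "is_lin T \<Longrightarrow> T 0 = 0"
  using is_lin_sc[of T 0 0] by simp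

lemma is_lin_sum: "is_lin T \<Longrightarrow> T (sum f A) = (\<Sum>a\<in>A. T (f a))"
  by (induction A rule: infinite_finite_induct) (simp_all add: is_lin_add is_lin_zero)

lemma lin_superset:
  assumes "finite A" "Poly_Mapping.keys x \<subseteq> A"
  shows "lin f x = (\<Sum>u\<in>A. sc (Poly_Mapping.lookup x u) (f u))"
  unfolding lin_def using assms
  by (intro sum.mono_neutral_left) (auto simp: in_keys_iff)

lemma is_lin_lin [simp, intro]: "is_lin (lin f)"
proof -
  have "lin f (x + y) = lin f x + lin f y" for x y
    using Poly_Mapping.keys_add[of x y]
    by (simp add: lin_superset[of "Poly_Mapping.keys x \<union> Poly_Mapping.keys y"] lookup_add sc_add_left sum.distrib)
  moreover have "lin f (sc c x) = sc c (lin f x)" for c x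
    by (subst lin_superset[of "Poly_Mapping.keys x"]) (auto simp: lin_def sc_sum in_keys_iff)
  ultimately show ?thesis by (simp add: is_lin_def)
qed

lemma lin_e [simp]: "lin f (bvec u) = f u"
  by (simp add: lin_def)

lemma expand: "x = lin bvec x"
proof (rule poly_mapping_eqI)
  fix u
  have "Poly_Mapping.lookup (lin bvec x) u = (\<Sum>v\<in>Poly_Mapping.keys x. if v = u then Poly_Mapping.lookup x v else 0)"
    unfolding lin_def lookup_sum by (rule sum.cong) (auto simp: lookup_single)
  then show "Poly_Mapping.lookup x u = Poly_Mapping.lookup (lin bvec x) u" by (simp add: in_keys_iff)
qed

lemma is_lin_expand:
  assumes "is_lin T"
  shows "T x = lin (\<lambda>u. T (bvec u)) x"
proof -
  have "T x = T (lin bvec x)" by (simp flip: expand)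
  then show ?thesis using assms by (simp add: lin_def is_lin_sum is_lin_sc)
qed

lemma is_lin_eqI:
  assumes "is_lin S" "is_lin T" "\<And>u. S (bvec u) = T (bvec u)"
  shows "S x = T x"
  using is_lin_expand[OF assms(1), of x] is_lin_expand[OF assms(2), of x] assms(3) by simp

lemma is_lin_comp: "is_lin S \<Longrightarrow> is_lin T \<Longrightarrow> is_lin (\<lambda>x. S (T x))"
  by (simp add: is_lin_def)

lemma is_lin_fold:
  assumes "\<And>i. is_lin (F i)"
  shows "is_lin (fold F a)"
proof (induction a)
  case (Cons i a)
  then show ?case using is_lin_comp[OF Cons assms] by (simp add: comp_def)
qed (simp add: is_lin_def)

lemma is_lin_lin_left:
  assumes "\<And>v. is_lin (\<lambda>x. f x v)"
  shows "is_lin (\<lambda>x. lin (f x) y)"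
proof -
  have "lin (f (x + z)) y = lin (f x) y + lin (f z) y" for x z
    using assms by (simp add: lin_def is_lin_def sc_add sum.distrib)
  moreover have "lin (f (sc c x)) y = sc c (lin (f x) y)" for c x
    using assms by (simp add: lin_def is_lin_def sc_sum mult.commute)
  ultimately show ?thesis by (simp add: is_lin_def)
qed

subsection \<open>Commuting left and right actions\<close>

definition left_simple :: "int \<Rightarrow> idc_module \<Rightarrow> idc_module" where
  "left_simple j = lin (\<lambda>u.
     if cox_length u < cox_length (simple j * u) then bvec (simple j * u) else sc \<beta> (bvec u))"

lemma is_lin_right_simple [simp]: "is_lin (right_simple i)"
  by (simp add: right_simple_def)

lemma is_lin_left_simple [simp]: "is_lin (left_simple i)"
  by (simp add: left_simple_def)

lemma right_simple_e:
  "right_simple i (bvec u) = (if u \<langle>$\<rangle> i < u \<langle>$\<rangle> (i + 1) then bvec (u * simple i) else sc \<beta> (bvec u))"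
  by (simp add: right_simple_def ascent_iff)

lemma left_simple_e:
  "left_simple j (bvec u) =
     (if inverse u \<langle>$\<rangle> j < inverse u \<langle>$\<rangle> (j + 1) then bvec (simple j * u) else sc \<beta> (bvec u))"
  by (simp add: left_simple_def left_ascent_iff)

lemma left_right_e: "left_simple j (right_simple i (bvec u)) = right_simple i (left_simple j (bvec u))"
proof -
  define A where "A \<longleftrightarrow> u \<langle>$\<rangle> i < u \<langle>$\<rangle> (i + 1)"
  define B where "B \<longleftrightarrow> inverse u \<langle>$\<rangle> j < inverse u \<langle>$\<rangle> (j + 1)"
  define A' where "A' \<longleftrightarrow> (simple j * u) \<langle>$\<rangle> i < (simple j * u) \<langle>$\<rangle> (i + 1)"
  define B' where "B' \<longleftrightarrow> inverse (u * simple i) \<langle>$\<rangle> j < inverse (u * simple i) \<langle>$\<rangle> (j + 1)"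
  define p where "p = inverse u \<langle>$\<rangle> j"
  define r where "r = inverse u \<langle>$\<rangle> (j + 1)"
  have up: "u \<langle>$\<rangle> p = j" "u \<langle>$\<rangle> r = j + 1" by (simp_all add: p_def r_def)
  have pr: "p \<noteq> r" using up by force
  have L: "left_simple j (right_simple i (bvec u)) =
      (if A then if B' then bvec (simple j * u * simple i) else sc \<beta> (bvec (u * simple i))
       else if B then sc \<beta> (bvec (simple j * u)) else sc (\<beta> * \<beta>) (bvec u))"
    by (simp only: right_simple_e left_simple_e A_def B_def B'_def is_lin_sc is_lin_left_simple
        mult.assoc sc_sc split: if_split) simp
  have R: "right_simple i (left_simple j (bvec u)) =
      (if B then if A' then bvec (simple j * u * simple i) else sc \<beta> (bvec (simple j * u))
       else if A then sc \<beta> (bvec (u * simple i)) else sc (\<beta> * \<beta>) (bvec u))"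
    by (simp only: right_simple_e left_simple_e A_def B_def A'_def is_lin_sc is_lin_right_simple
        mult.assoc sc_sc split: if_split) simp
  have B': "B' \<longleftrightarrow> simple i \<langle>$\<rangle> p < simple i \<langle>$\<rangle> r"
    by (simp add: B'_def apply_times p_def r_def)
  have A': "A' \<longleftrightarrow> simple j \<langle>$\<rangle> (u \<langle>$\<rangle> i) < simple j \<langle>$\<rangle> (u \<langle>$\<rangle> (i + 1))"
    by (simp add: A'_def apply_times)
  have B: "B \<longleftrightarrow> p < r" by (simp add: B_def p_def r_def)
  show ?thesis
  proof (cases "{p, r} = {i, i + 1}")
    case True
    have eq: "simple j * u = u * simple i"
    proof (rule perm_eqI)
      fix x
      show "(simple j * u) \<langle>$\<rangle> x = (u * simple i) \<langle>$\<rangle> x"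
        using True up apply_inj[of u x p] apply_inj[of u x r]
        by (auto simp: apply_times apply_simple doubleton_eq_iff)
    qed
    have "A \<longleftrightarrow> B" "B' \<longleftrightarrow> \<not> B" "A' \<longleftrightarrow> \<not> A"
      using True up by (auto simp: A_def B B' A' apply_simple doubleton_eq_iff)
    then show ?thesis by (simp add: L R eq)
  next
    case False
    have B'B: "B' \<longleftrightarrow> B"
      using False pr by (auto simp: B B' apply_simple doubleton_eq_iff split: if_splits)
    have "{u \<langle>$\<rangle> i, u \<langle>$\<rangle> (i + 1)} \<noteq> {j, j + 1}"
      using False up apply_inj[of u] by (metis doubleton_eq_iff)
    then have A'A: "A' \<longleftrightarrow> A"
      using apply_neq_Suc[of u i] by (auto simp: A_def A' apply_simple doubleton_eq_iff split: if_splits)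
    show ?thesis by (simp add: L R B'B A'A)
  qed
qed

lemma left_right: "left_simple j (right_simple i x) = right_simple i (left_simple j x)"
  by (rule is_lin_eqI[OF is_lin_comp is_lin_comp]) (simp_all add: left_right_e)

lemma fold_left_right:
  "fold left_simple a (fold right_simple c x) = fold right_simple c (fold left_simple a x)"
proof -
  have 1: "left_simple j (fold right_simple c x) = fold right_simple c (left_simple j x)" for j c x
    by (induction c arbitrary: x) (simp_all add: left_right)
  show ?thesis by (induction a arbitrary: x) (simp_all add: 1)
qed

lemma reduced_snoc:
  assumes "length (a @ [i]) = cox_length (prod_list (map simple (a @ [i])))"
  shows "length a = cox_length (prod_list (map simple a))"
    and "prod_list (map simple a) \<langle>$\<rangle> i < prod_list (map simple a) \<langle>$\<rangle> (i + 1)"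
proof -
  let ?w = "prod_list (map simple a)"
  show "?w \<langle>$\<rangle> i < ?w \<langle>$\<rangle> (i + 1)" "length a = cox_length ?w"
    using assms cox_length_mult_simple[of ?w i] cox_length_prod_list_le[of a]
    by (auto split: if_splits)
qed

lemma fold_right_reduced:
  "length a = cox_length (prod_list (map simple a)) \<Longrightarrow>
     fold right_simple a (bvec 1) = bvec (prod_list (map simple a))"
proof (induction a rule: rev_induct)
  case (snoc i a)
  then show ?case using reduced_snoc[OF snoc.prems] by (simp add: right_simple_e)
qed simp

lemma reduced_Cons:
  assumes "length (i # a) = cox_length (prod_list (map simple (i # a)))"
  defines "v \<equiv> prod_list (map simple a)"
  shows "length a = cox_length v" "inverse v \<langle>$\<rangle> i < inverse v \<langle>$\<rangle> (i + 1)"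
proof -
  have "inverse (simple i * v) = inverse v * simple i" by simp
  then have *: "cox_length (simple i * v) = cox_length (inverse v * simple i)"
    by (metis cox_length_inverse)
  show "length a = cox_length v" "inverse v \<langle>$\<rangle> i < inverse v \<langle>$\<rangle> (i + 1)"
    using assms(1) * cox_length_mult_simple[of "inverse v" i] cox_length_prod_list_le[of a]
    by (auto simp: v_def split: if_splits)
qed

lemma fold_left_reduced:
  "length a = cox_length (prod_list (map simple a)) \<Longrightarrow>
     fold left_simple (rev a) (bvec 1) = bvec (prod_list (map simple a))"
proof (induction a)
  case (Cons i a)
  then show ?case using reduced_Cons[OF Cons.prems] by (simp add: left_simple_e)
qed simp

lemma reduced_word:
  "length (reduced_word v) = cox_length v" "prod_list (map simple (reduced_word v)) = v"
  using someI_ex[OF ex_reduced_word[of v]] by (auto simp: reduced_word_def)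

definition left_act :: "int perm \<Rightarrow> idc_module \<Rightarrow> idc_module" where
  "left_act u = fold left_simple (rev (reduced_word u))"

definition right_act :: "int perm \<Rightarrow> idc_module \<Rightarrow> idc_module" where
  "right_act v = fold right_simple (reduced_word v)"

lemma is_lin_act [simp]: "is_lin (left_act u)" "is_lin (right_act u)"
  by (simp_all add: left_act_def right_act_def is_lin_fold)

lemma left_act_e1 [simp]: "left_act u (bvec 1) = bvec u"
  by (simp add: left_act_def fold_left_reduced reduced_word)

lemma fold_right_e:
  assumes "length a = cox_length (prod_list (map simple a))"
  shows "fold right_simple a (bvec u) = left_act u (bvec (prod_list (map simple a)))"
proof -
  have "fold right_simple a (bvec u) = fold right_simple a (left_act u (bvec 1))" by simp
  also have "\<dots> = left_act u (fold right_simple a (bvec 1))"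
    unfolding left_act_def by (rule fold_left_right[symmetric])
  finally show ?thesis using fold_right_reduced[OF assms] by simp
qed

lemma right_act_e: "right_act v (bvec u) = left_act u (bvec v)"
  unfolding right_act_def using fold_right_e[of "reduced_word v"] by (simp add: reduced_word)

lemma right_act_1 [simp]: "right_act 1 x = x"
  using reduced_word(1)[of 1] by (simp add: right_act_def)

lemma left_act_1 [simp]: "left_act 1 x = x"
  using reduced_word(1)[of 1] by (simp add: left_act_def)

lemma left_right_act: "left_act u (right_act v x) = right_act v (left_act u x)"
  by (simp add: left_act_def right_act_def fold_left_right)

lemma idc_mult_alt: "idc_mult x y = lin (\<lambda>v. right_act v x) y"
  by (simp add: idc_mult_def right_act_def)

lemma is_lin_idc_mult [simp]: "is_lin (idc_mult x)" "is_lin (\<lambda>x. idc_mult x y)"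
proof -
  show "is_lin (\<lambda>x. idc_mult x y)"
    unfolding idc_mult_alt by (rule is_lin_lin_left) (simp flip: eta_contract_eq)
  show "is_lin (idc_mult x)"
    using is_lin_lin[of "\<lambda>v. right_act v x"] by (simp add: is_lin_def idc_mult_alt)
qed

lemma idc_mult_e_right [simp]: "idc_mult x (bvec v) = right_act v x"
  by (simp add: idc_mult_alt)

lemma idc_mult_e_left [simp]: "idc_mult (bvec u) y = left_act u y"
  by (rule is_lin_eqI) (simp_all add: right_act_e)

lemma idc_mult_assoc: "idc_mult (idc_mult x y) z = idc_mult x (idc_mult y z)"
proof -
  have 1: "idc_mult (idc_mult (bvec u) (bvec v)) z = idc_mult (bvec u) (idc_mult (bvec v) z)" for u v
    by (rule is_lin_eqI[OF is_lin_idc_mult(1) is_lin_comp[OF is_lin_idc_mult(1) is_lin_idc_mult(1)]])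
       (simp only: idc_mult_e_right, simp only: idc_mult_e_left left_right_act flip: right_act_e)
  have 2: "idc_mult (idc_mult (bvec u) y) z = idc_mult (bvec u) (idc_mult y z)" for u
    by (rule is_lin_eqI[OF is_lin_comp[OF is_lin_idc_mult(2) is_lin_idc_mult(1)]
          is_lin_comp[OF is_lin_idc_mult(1) is_lin_idc_mult(2)]]) (rule 1)
  show ?thesis
    by (rule is_lin_eqI[OF is_lin_comp[OF is_lin_idc_mult(2) is_lin_idc_mult(2)]
          is_lin_idc_mult(2)]) (rule 2)
qed

lemma idc_mult_reduced:
  assumes "cox_length (u * v) = cox_length u + cox_length v"
  shows "idc_mult (bvec u) (bvec v) = bvec (u * v)"
proof -
  let ?a = "reduced_word u @ reduced_word v"
  have "fold right_simple ?a (bvec 1) = bvec (u * v)"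
    using fold_right_reduced[of ?a] assms by (simp add: reduced_word)
  moreover have "fold right_simple (reduced_word u) (bvec 1) = bvec u"
    using fold_right_reduced[of "reduced_word u"] by (simp add: reduced_word)
  ultimately show ?thesis
    by (simp only: fold_append comp_apply idc_mult_e_right right_act_def)
qed

lemma cox_length_simple [simp]: "cox_length (simple i) = 1"
  using cox_length_mult_simple[of 1 i] by simp

lemma idc_mult_simple [simp]: "idc_mult x (bvec (simple i)) = right_simple i x"
proof (rule is_lin_eqI[OF is_lin_idc_mult(2) is_lin_right_simple])
  fix u
  show "idc_mult (bvec u) (bvec (simple i)) = right_simple i (bvec u)"
    using fold_right_e[of "[i]" u] by (simp del: idc_mult_e_right)
qed

subsection \<open>The algebra as a ring\<close>

typedef idcox = "UNIV :: idc_module set"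
  morphisms rep_idcox Abs_idcox ..

setup_lifting type_definition_idcox

instantiation idcox :: ring_1
begin
lift_definition zero_idcox :: idcox is 0 .
lift_definition one_idcox :: idcox is "bvec 1" .
lift_definition plus_idcox :: "idcox \<Rightarrow> idcox \<Rightarrow> idcox" is "(+)" .
lift_definition minus_idcox :: "idcox \<Rightarrow> idcox \<Rightarrow> idcox" is "(-)" .
lift_definition uminus_idcox :: "idcox \<Rightarrow> idcox" is uminus .
lift_definition times_idcox :: "idcox \<Rightarrow> idcox \<Rightarrow> idcox" is idc_mult .
instance
proof
  fix a b c :: idcox
  show "a * b * c = a * (b * c)" by transfer (rule idc_mult_assoc)
  show "1 * a = a" by transfer simp
  show "a * 1 = a" by transfer simp
  show "(a + b) * c = a * c + b * c" by transfer (rule is_lin_add[OF is_lin_idc_mult(2)])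
  show "a * (b + c) = a * b + a * c" by transfer (rule is_lin_add[OF is_lin_idc_mult(1)])
  show "(0::idcox) \<noteq> 1"
    by transfer (metis lookup_single_eq lookup_zero zero_neq_one)
qed (transfer; simp add: algebra_simps)+
end

lift_definition idc_scale :: "int poly \<Rightarrow> idcox \<Rightarrow> idcox" is sc .

lift_definition idc_basis :: "int perm \<Rightarrow> idcox" is bvec .

lemma rep_idcox_sum: "rep_idcox (sum f A) = (\<Sum>a\<in>A. rep_idcox (f a))"
  by (induction A rule: infinite_finite_induct) (simp_all add: zero_idcox.rep_eq plus_idcox.rep_eq)

lemma inj_idc_basis: "inj idc_basis"
  by (rule injI) (metis idc_basis.rep_eq lookup_single_eq lookup_single_not_eq zero_neq_one)

interpretation idcox: id_coxeter_algebra idc_scale idc_basis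
proof -
  interpret module idc_scale
    by unfold_locales (transfer; simp add: sc_add sc_add_left)+
  show "id_coxeter_algebra idc_scale idc_basis"
  proof
    fix c :: "int poly" and x y :: idcox and u v :: "int perm" and i :: int
    show "idc_scale c x * y = idc_scale c (x * y)"
      by transfer (rule is_lin_sc[OF is_lin_idc_mult(2)])
    show "x * idc_scale c y = idc_scale c (x * y)"
      by transfer (rule is_lin_sc[OF is_lin_idc_mult(1)])
    show "inj idc_basis" by (rule inj_idc_basis)
    show "idc_basis u * idc_basis v = idc_basis (u * v)"
      if "cox_length (u * v) = cox_length u + cox_length v"
      using that by transfer (rule idc_mult_reduced)
    show "idc_basis (simple i) * idc_basis (simple i) = idc_scale \<beta> (idc_basis (simple i))"
      by transfer (simp add: right_simple_e apply_simple del: idc_mult_e_left idc_mult_e_right)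
    show "independent (range idc_basis)"
      unfolding independent_explicit_module
    proof (intro allI impI)
      fix t :: "idcox set" and c :: "idcox \<Rightarrow> int poly" and z
      assume t: "finite t" "t \<subseteq> range idc_basis" and 0: "(\<Sum>z\<in>t. idc_scale (c z) z) = 0" and "z \<in> t"
      then obtain u where u: "z = idc_basis u" by blast
      have "Poly_Mapping.lookup (rep_idcox z') u = (if z' = z then 1 else 0)" if "z' \<in> t" for z'
        using that t(2) u inj_idc_basis by (auto simp: idc_basis.rep_eq lookup_single when_def dest: injD)
      then have "(\<Sum>z'\<in>t. c z' * Poly_Mapping.lookup (rep_idcox z') u) = (\<Sum>z'\<in>t. if z' = z then c z' else 0)"
        by (intro sum.cong) auto
      moreover have "Poly_Mapping.lookup (rep_idcox (\<Sum>z\<in>t. idc_scale (c z) z)) u = 0"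
        unfolding 0 by (simp add: zero_idcox.rep_eq)
      ultimately show "c z = 0"
        using t(1) \<open>z \<in> t\<close> by (simp add: rep_idcox_sum lookup_sum idc_scale.rep_eq)
    qed
    have "x \<in> span (range idc_basis)" for x
    proof -
      have "rep_idcox x = rep_idcox (\<Sum>u\<in>Poly_Mapping.keys (rep_idcox x). idc_scale (Poly_Mapping.lookup (rep_idcox x) u) (idc_basis u))"
        by (subst expand) (simp add: lin_def rep_idcox_sum idc_scale.rep_eq idc_basis.rep_eq)
      then have "x = (\<Sum>u\<in>Poly_Mapping.keys (rep_idcox x). idc_scale (Poly_Mapping.lookup (rep_idcox x) u) (idc_basis u))"
        by (simp add: rep_idcox_inject)
      also have "\<dots> \<in> span (range idc_basis)"
        by (intro span_sum span_scale span_base) auto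
      finally show ?thesis .
    qed
    then show "span (range idc_basis) = UNIV" by blast
  qed
qed


section \<open>Backstable Grothendieck polynomials\<close>

text \<open>
  The explicit bound on \<open>cox_length w\<close> only keeps the exponent from being truncated.
\<close>
definition hecke :: "nat \<Rightarrow> int perm \<Rightarrow> int list set" where
  "hecke n w = {a. (\<forall>i\<in>set a. i < int n) \<and> cox_length w \<le> length a \<and>
     prod_list (map (\<lambda>i. idc_basis (simple i)) a) =
       idc_scale (\<beta> ^ (length a - cox_length w)) (idc_basis w)}"

text \<open>Lists are indexed from 0, so the position \<open>i\<close> below compares the letters \<open>a\<^sub>i\<close> and \<open>a\<^sub>i\<^sub>+\<^sub>1\<close>.\<close>
definition comaj :: "int list \<Rightarrow> nat" where
  "comaj a = \<Sum>{i. 1 \<le> i \<and> i < length a \<and> a ! (i - 1) < a ! i}"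

definition compatible :: "int list \<Rightarrow> int list set" where
  "compatible a = {js. length js = length a \<and> sorted js \<and>
     (\<forall>k. Suc k < length a \<longrightarrow> a ! k \<le> a ! Suc k \<longrightarrow> js ! k < js ! Suc k) \<and>
     (\<forall>k < length a. 0 < js ! k \<longrightarrow> js ! k \<le> a ! k)}"

text \<open>
  A formal power series over \<open>int poly\<close> in the variables \<open>x\<^sub>i\<close> is given by its coefficients,
  a monomial being the multiset of the indices of its variables.
\<close>
type_synonym power_series = "int multiset \<Rightarrow> int poly"

definition backstable_grothendieck :: "nat \<Rightarrow> int perm \<Rightarrow> power_series" where
  "backstable_grothendieck n w m =
     (\<Sum>(a, js) \<in> {(a, js). a \<in> hecke n w \<and> js \<in> compatible a \<and> mset js = m}.
        \<beta> ^ (length js - cox_length w))"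

subsection \<open>The coefficients are finite sums\<close>

lemma idc_scale_basis_mult_simple:
  "idc_scale c (idc_basis u) * idc_basis (simple i) =
     (if u \<langle>$\<rangle> i < u \<langle>$\<rangle> (i + 1) then idc_scale c (idc_basis (u * simple i))
      else idc_scale (c * \<beta>) (idc_basis u))"
  by transfer (simp add: is_lin_sc[OF is_lin_right_simple] right_simple_e
      del: idc_mult_e_left idc_mult_e_right)

lemma idc_scale_basis_eqD:
  assumes "idc_scale c (idc_basis u) = idc_scale d (idc_basis w)" "c \<noteq> 0"
  shows "u = w"
proof (rule ccontr)
  assume "u \<noteq> w"
  have "Poly_Mapping.lookup (rep_idcox (idc_scale c (idc_basis u))) u = c"
    by (simp add: idc_scale.rep_eq idc_basis.rep_eq)
  moreover have "Poly_Mapping.lookup (rep_idcox (idc_scale d (idc_basis w))) u = 0"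
    using \<open>u \<noteq> w\<close> by (simp add: idc_scale.rep_eq idc_basis.rep_eq lookup_single)
  ultimately show False using assms by simp
qed

definition support :: "int perm \<Rightarrow> int set" where
  "support w = {j. \<exists>x\<le>j. j < w \<langle>$\<rangle> x}"

lemma finite_support: "finite (support w)"
proof -
  obtain M where M: "M \<ge> 0" "\<And>x. \<bar>x\<bar> > M \<Longrightarrow> w \<langle>$\<rangle> x = x" "\<And>x. \<bar>x\<bar> \<le> M \<Longrightarrow> \<bar>w \<langle>$\<rangle> x\<bar> \<le> M"
    using perm_bound[of w] by blast
  have "-M \<le> j \<and> j \<le> M" if "x \<le> j" "j < w \<langle>$\<rangle> x" for x j
    using that M(2)[of x] M(3)[of x] by linarith
  then have "support w \<subseteq> {-M..M}" by (auto simp: support_def)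
  then show ?thesis by (rule finite_subset) simp
qed

lemma ex_apply_gt:
  fixes u :: "int perm"
  shows "\<exists>x\<le>i + 1. i < u \<langle>$\<rangle> x"
proof (rule ccontr)
  assume *: "\<not> ?thesis"
  obtain M where M: "M \<ge> 0" "\<And>x. \<bar>x\<bar> > M \<Longrightarrow> u \<langle>$\<rangle> x = x" "\<And>x. \<bar>x\<bar> \<le> M \<Longrightarrow> \<bar>u \<langle>$\<rangle> x\<bar> \<le> M"
    using perm_bound[of u] by blast
  define L where "L = M + \<bar>i\<bar> + 1"
  have "Perm.apply u ` {-L..i + 1} \<subseteq> {-L..i}"
  proof clarify
    fix x assume x: "x \<in> {-L..i + 1}"
    then have "u \<langle>$\<rangle> x \<le> i" using * by auto
    moreover have "-L \<le> u \<langle>$\<rangle> x"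
      using x M(1) M(2)[of x] M(3)[of x] by (cases "\<bar>x\<bar> \<le> M") (auto simp: L_def)
    ultimately show "u \<langle>$\<rangle> x \<in> {-L..i}" by simp
  qed
  then have "card {-L..i + 1} \<le> card {-L..i}"
    by (intro card_inj_on_le[of "Perm.apply u"]) (auto simp: inj_on_def apply_inj)
  then show False using M(1) by (simp add: L_def)
qed

lemma support_mult_simple:
  assumes "u \<langle>$\<rangle> i < u \<langle>$\<rangle> (i + 1)"
  shows "insert i (support u) \<subseteq> support (u * simple i)"
proof -
  have "i \<in> support (u * simple i)"
  proof (cases "i < u \<langle>$\<rangle> (i + 1)")
    case True
    then show ?thesis by (auto simp: support_def apply_times apply_simple intro!: exI[of _ i])
  next
    case False
    obtain x where x: "x \<le> i + 1" "i < u \<langle>$\<rangle> x" using ex_apply_gt by blast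
    with False assms have "x \<noteq> i + 1" "x \<noteq> i" by auto
    with x show ?thesis by (auto simp: support_def apply_times apply_simple intro!: exI[of _ x])
  qed
  moreover have "j \<in> support (u * simple i)" if j: "j \<in> support u" "j \<noteq> i" for j
  proof -
    obtain x where "x \<le> j" "j < u \<langle>$\<rangle> x" using j by (auto simp: support_def)
    with j(2) have "simple i \<langle>$\<rangle> x \<le> j" "j < (u * simple i) \<langle>$\<rangle> (simple i \<langle>$\<rangle> x)"
      by (auto simp: apply_times apply_simple)
    then show ?thesis by (auto simp: support_def)
  qed
  ultimately show ?thesis by blast
qed

lemma in_support_descent:
  assumes "\<not> u \<langle>$\<rangle> i < u \<langle>$\<rangle> (i + 1)"
  shows "i \<in> support u"
proof -
  obtain x where x: "x \<le> i + 1" "i < u \<langle>$\<rangle> x" using ex_apply_gt by blast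
  show ?thesis
  proof (cases "x = i + 1")
    case True
    with x assms show ?thesis by (auto simp: support_def intro!: exI[of _ i])
  next
    case False
    with x show ?thesis by (auto simp: support_def intro!: exI[of _ x])
  qed
qed

lemma prod_list_idc_basis:
  "\<exists>k u. prod_list (map (\<lambda>i. idc_basis (simple i)) a) = idc_scale (\<beta> ^ k) (idc_basis u) \<and>
     set a \<subseteq> support u"
proof (induction a rule: rev_induct)
  case Nil
  have "idc_scale 1 (idc_basis 1) = 1" by transfer simp
  then show ?case by (intro exI[of _ 0] exI[of _ 1]) simp
next
  case (snoc i a)
  then obtain k u where
    ku: "prod_list (map (\<lambda>i. idc_basis (simple i)) a) = idc_scale (\<beta> ^ k) (idc_basis u)"
      "set a \<subseteq> support u" by blast
  show ?case
  proof (cases "u \<langle>$\<rangle> i < u \<langle>$\<rangle> (i + 1)")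
    case True
    then show ?thesis using ku support_mult_simple[OF True]
      by (intro exI[of _ k] exI[of _ "u * simple i"]) (auto simp: idc_scale_basis_mult_simple)
  next
    case False
    then show ?thesis using ku in_support_descent[OF False]
      by (intro exI[of _ "Suc k"] exI[of _ u]) (auto simp: idc_scale_basis_mult_simple mult.commute)
  qed
qed

lemma hecke_support:
  assumes "a \<in> hecke n w"
  shows "set a \<subseteq> support w"
proof -
  obtain k u where
    ku: "prod_list (map (\<lambda>i. idc_basis (simple i)) a) = idc_scale (\<beta> ^ k) (idc_basis u)"
      "set a \<subseteq> support u" using prod_list_idc_basis by blast
  with assms have "u = w"
    by (intro idc_scale_basis_eqD[of "\<beta> ^ k"]) (auto simp: hecke_def)
  with ku show ?thesis by simp
qed

lemma finite_backstable_grothendieck: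
  "finite {(a, js). a \<in> hecke n w \<and> js \<in> compatible a \<and> mset js = m}"
proof (rule finite_subset)
  show "{(a, js). a \<in> hecke n w \<and> js \<in> compatible a \<and> mset js = m} \<subseteq>
    {a. set a \<subseteq> support w \<and> length a = size m} \<times> permutations_of_multiset m"
    using hecke_support by (auto simp: compatible_def permutations_of_multiset_def)
  show "finite ({a. set a \<subseteq> support w \<and> length a = size m} \<times> permutations_of_multiset m)"
    by (intro finite_cartesian_product finite_lists_length_eq finite_support) simp
qed


section \<open>Laurent series in the inverse of \<open>q\<close>\<close>

text \<open>
  Laurent series in the inverse of \<open>q\<close> are elements of \<open>int poly fls\<close> whose formal variable is
  the inverse of \<open>q\<close>. Infinite sums are taken in the metric topology of \<open>fls\<close>.
\<close>
definition q_pow :: "int \<Rightarrow> int poly fls" where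
  "q_pow k = fls_X_intpow (- k)"

lemma q_pow_add: "q_pow (k + l) = q_pow k * q_pow l"
  using fls_X_intpow_times_conv_shift(1)[of "- k" "fls_shift l (1 :: int poly fls)"]
  by (simp add: q_pow_def)

definition inv_q_factorial :: "nat \<Rightarrow> int poly fls" where
  "inv_q_factorial p = fls_right_inverse (\<Prod>k=1..p. (q_pow (int k) - 1)) 1"

lemma inv_q_factorial: "(\<Prod>k=1..p. (q_pow (int k) - 1)) * inv_q_factorial p = 1"
proof -
  have 1: "fls_subdegree (q_pow (int k) - 1) = - int k"
    and 2: "fls_nth (q_pow (int k) - 1) (- int k) = 1" if "k \<ge> 1" for k
    using that by (auto intro!: fls_subdegree_eqI simp: q_pow_def)
  have "fls_nth (\<Prod>k=1..p. (q_pow (int k) - 1))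
      (fls_subdegree (\<Prod>k=1..p. (q_pow (int k) - 1))) = 1"
  proof (induction p)
    case (Suc p)
    let ?f = "\<Prod>k=1..p. (q_pow (int k) - 1)" and ?g = "q_pow (int (Suc p)) - 1"
    have base: "fls_nth ?f (fls_subdegree ?f) = 1" by (rule Suc)
    have "?f \<noteq> 0" using base by (metis fls_zero_nth zero_neq_one)
    moreover have "?g \<noteq> 0" using 2[of "Suc p"] by (metis fls_zero_nth zero_neq_one le_add1 plus_1_eq_Suc)
    ultimately have deg: "fls_subdegree (?f * ?g) = fls_subdegree ?f + fls_subdegree ?g"
      by (rule fls_subdegree_mult)
    have "fls_nth (?f * ?g) (fls_subdegree (?f * ?g)) = 1"
      unfolding deg fls_times_base base using 1[of "Suc p"] 2[of "Suc p"] by simp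
    then show ?case by (simp only: prod.cl_ivl_Suc) simp
  qed simp
  then show ?thesis unfolding inv_q_factorial_def by (intro fls_right_inverse) (simp only: mult_1_right)
qed

definition monomials :: "nat \<Rightarrow> int multiset set" where
  "monomials n = {m. set_mset m \<subseteq> {..<int n}}"

definition principal_term :: "power_series \<Rightarrow> int multiset \<Rightarrow> int poly fls" where
  "principal_term F m = fls_const (F m) * (\<Prod>i\<in>#m. q_pow (i - 1))"

definition principal_specialization :: "nat \<Rightarrow> power_series \<Rightarrow> int poly fls" where
  "principal_specialization n F = (\<Sum>\<^sub>\<infinity>m\<in>monomials n. principal_term F m)"

end

theory Submission
  imports Defs
begin

text \<open>
  Both sides are generating functions of the same finite sets of factors \<open>q\<^bsup>j - 1\<^esup> \<pi>\<^sub>a\<close> with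
  \<open>1 \<le> a < n\<close> and \<open>j \<le> a\<close>. A word with a compatible sequence \<open>j\<close> is such a set read by increasing
  \<open>j\<close>, then decreasing \<open>a\<close>. Reading instead by increasing \<open>i = j - a - 1\<close>, then increasing \<open>a\<close>,
  gives a word with a negative weakly increasing sequence \<open>i\<close> that is strict wherever the word does
  not ascend, and for a fixed word \<open>a\<close> these sequences contribute
  \<open>q\<^bsup>comaj a\<^esup> / ((q - 1) \<cdots> (q\<^bsup>p\<^esup> - 1))\<close>. The two readings agree on the relative order of factors
  whose letters differ by one, so they are related by commutations and have the same Demazure product.
\<close>

section \<open>Sums of Laurent series\<close>

lemma dist_fls_less:
  fixes f g :: "'a::group_add fls"
  assumes "\<And>k. k \<le> int N \<Longrightarrow> fls_nth f k = fls_nth g k"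
  shows "dist f g < inverse (2 ^ N)"
proof (cases "f = g")
  case False
  then have "fls_nth (f - g) (fls_subdegree (f - g)) \<noteq> 0"
    by (intro nth_fls_subdegree_nonzero) simp
  then have "int N < fls_subdegree (f - g)"
    using assms by (metis diff_self fls_minus_nth not_le)
  then have "N < nat (fls_subdegree (f - g))" "fls_subdegree (f - g) \<ge> 0" by linarith+
  then show ?thesis using False
    by (simp add: dist_fls_def power_strict_increasing)
qed simp

text \<open>Both sides of the theorem arise as sums over the fibres of a map on a graded set. Only
  finitely many objects have degree at most \<open>N\<close>, so a partial sum over a set containing
  all their images is exact up to order \<open>N\<close>.\<close>

lemma has_sum_fls_fibres:
  fixes F :: "'a \<Rightarrow> 'c::ab_group_add fls" and d :: "'x \<Rightarrow> int"
  assumes fin: "\<And>N. finite {x \<in> X. d x \<le> N}"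
    and S: "\<And>k. fls_nth S k = (\<Sum>x | x \<in> X \<and> d x = k. c x)"
    and F: "\<And>a k. a \<in> A \<Longrightarrow> fls_nth (F a) k = (\<Sum>x | x \<in> X \<and> \<phi> x = a \<and> d x = k. c x)"
    and \<phi>: "\<phi> ` X \<subseteq> A"
  shows "(F has_sum S) A"
  unfolding has_sum_def tendsto_iff
proof (intro allI impI)
  fix e :: real
  assume "e > 0"
  then obtain N where N: "inverse (2 ^ N) < e"
    using reals_power_lt_ex[of e 2] by (auto simp: power_one_over inverse_eq_divide)
  have "dist (sum F B) S < e" if B: "finite B" "\<phi> ` {x \<in> X. d x \<le> int N} \<subseteq> B" "B \<subseteq> A" for B
  proof -
    have "fls_nth (sum F B) k = fls_nth S k" if "k \<le> int N" for k
    proof -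
      have fin': "finite {x. x \<in> X \<and> d x = k}"
        by (rule finite_subset[OF _ fin[of k]]) auto
      have "fls_nth (sum F B) k = (\<Sum>a\<in>B. fls_nth (F a) k)"
        using B(1) by (induction B) auto
      also have "\<dots> = (\<Sum>a\<in>B. \<Sum>x | x \<in> {x. x \<in> X \<and> d x = k} \<and> \<phi> x = a. c x)"
        using B(3) by (intro sum.cong) (auto simp: F conj_ac intro!: sum.cong)
      also have "\<dots> = (\<Sum>x | x \<in> X \<and> d x = k. c x)"
        using B that by (intro sum.group fin') auto
      finally show ?thesis by (simp add: S)
    qed
    then show ?thesis using N dist_fls_less less_trans by blast
  qed
  moreover have "finite (\<phi> ` {x \<in> X. d x \<le> int N})" "\<phi> ` {x \<in> X. d x \<le> int N} \<subseteq> A"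
    using fin \<phi> by auto
  ultimately show "\<forall>\<^sub>F B in finite_subsets_at_top A. dist (sum F B) S < e"
    unfolding eventually_finite_subsets_at_top by blast
qed

lemma ex_fls_nth_eq_sum:
  fixes d :: "'x \<Rightarrow> int"
  assumes fin: "\<And>N. finite {x \<in> X. d x \<le> N}"
  shows "\<exists>S. \<forall>k. fls_nth S k = (\<Sum>x | x \<in> X \<and> d x = k. c x)"
proof -
  \<comment> \<open>Inserting \<open>0\<close> keeps \<open>Min\<close> defined when no degree is
    nonpositive, and forces \<open>k < 0\<close> below it.\<close>
  let ?B = "insert 0 (d ` {x \<in> X. d x \<le> 0})"
  have "(\<Sum>x | x \<in> X \<and> d x = k. c x) = 0" if "k < Min ?B" for k
  proof -
    have "k < 0" using that fin[of 0] by simp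
    then have "{x. x \<in> X \<and> d x = k} = {}"
      using that fin[of 0] by (auto simp: less_le_not_le dest: bspec)
    then show ?thesis by (simp only: sum.empty)
  qed
  then have "\<forall>k. fls_nth (Abs_fls (\<lambda>k. \<Sum>x | x \<in> X \<and> d x = k. c x)) k = (\<Sum>x | x \<in> X \<and> d x = k. c x)"
    by (intro allI nth_Abs_fls_lower_bound) blast
  then show ?thesis by blast
qed

lemma q_pow_times_nth [simp]:
  "fls_nth (q_pow e * f) k = fls_nth f (k + e)" "fls_nth (f * q_pow e) k = fls_nth f (k + e)"
  unfolding q_pow_def fls_X_intpow_times_conv_shift by simp_all

lemma q_pow_nth: "fls_nth (q_pow e) k = (if k = - e then 1 else 0)"
  by (simp add: q_pow_def)

lemma q_pow_0 [simp]: "q_pow 0 = 1"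
  by (simp add: q_pow_def)

lemma prod_mset_q_pow: "(\<Prod>i\<in>#m. q_pow (f i)) = q_pow (\<Sum>i\<in>#m. f i)"
  by (induction m) (simp_all add: q_pow_add)


section \<open>Products of commuting factors\<close>

text \<open>A product depends only on the relative order of its noncommuting pairs. The
  \<open>k\<close>-least factor can be pulled to the front of \<open>ys\<close>: whatever stands
  before it there is \<open>l\<close>-smaller but \<open>k\<close>-larger, so the two
  commute.\<close>

lemma prod_list_eq_of_commuting:
  fixes f :: "'b \<Rightarrow> 'a::monoid_mult" and k :: "'b \<Rightarrow> 'c::linorder" and l :: "'b \<Rightarrow> 'd::linorder"
  assumes "sorted_wrt (<) (map k xs)" "sorted_wrt (<) (map l ys)" "set xs = set ys"
    and "\<And>x y. x \<in> set xs \<Longrightarrow> y \<in> set xs \<Longrightarrow> f x * f y \<noteq> f y * f x \<Longrightarrow> k x < k y \<longleftrightarrow> l x < l y"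
  shows "prod_list (map f xs) = prod_list (map f ys)"
  using assms
proof (induction xs arbitrary: ys)
  case (Cons x xs)
  obtain P Q where ys: "ys = P @ x # Q" using Cons.prems(3) by (metis list.set_intros(1) split_list)
  have kx: "k x < k y" if "y \<in> set xs" for y using Cons.prems(1) that by simp
  have lP: "l y < l x" if "y \<in> set P" for y using Cons.prems(2) that by (simp add: ys sorted_wrt_append)
  have lQ: "l x < l y" if "y \<in> set Q" for y using Cons.prems(2) that by (simp add: ys sorted_wrt_append)
  have "x \<notin> set xs" "x \<notin> set P" "x \<notin> set Q" using kx lP lQ by blast+
  then have set: "set xs = set (P @ Q)" using Cons.prems(3) by (auto simp: ys)
  have comm: "f y * f x = f x * f y" if "y \<in> set P" for y
  proof (rule ccontr)
    assume "f y * f x \<noteq> f x * f y"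
    then have "k x < k y \<longleftrightarrow> l x < l y" using that Cons.prems(3) by (intro Cons.prems(4)) (auto simp: ys)
    moreover have "k x < k y" using kx set that by simp
    ultimately show False using lP[OF that] by simp
  qed
  have P: "prod_list (map f P) * f x = f x * prod_list (map f P)"
    using comm by (induction P) (simp_all add: mult.assoc, metis mult.assoc)
  have "prod_list (map f xs) = prod_list (map f (P @ Q))"
    using Cons.prems(1,2,4) set by (intro Cons.IH) (auto simp: ys sorted_wrt_append)
  then show ?case by (simp add: ys P flip: mult.assoc)
qed simp

text \<open>For distinct letters both products are reduced, so both are the basis element of one
  permutation.\<close>

lemma idc_basis_simple_commute:
  assumes "a \<noteq> b + 1" "b \<noteq> a + 1"
  shows "idc_basis (simple a) * idc_basis (simple b) = idc_basis (simple b) * idc_basis (simple a)"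
proof (cases "a = b")
  case False
  have "idc_basis (simple c) * idc_basis (simple d) = idc_basis (simple c * simple d)"
    if "c \<noteq> d + 1" "d \<noteq> c + 1" "c \<noteq> d" for c d
    using that by (intro idcox.basis_mult) (simp add: cox_length_mult_simple apply_simple)
  moreover have "simple a * simple b = simple b * simple a"
    using assms False by (intro perm_eqI) (auto simp: apply_times apply_simple)
  ultimately show ?thesis using assms False by simp
qed simp


section \<open>Two readings of a set of factors\<close>

text \<open>A low digit in \<open>[0, n)\<close> never outweighs a step of the high digit, so one
  integer key can encode a lexicographic order.\<close>

lemma lex_less_iff:
  fixes n :: int
  assumes "0 \<le> a" "a < n" "0 \<le> b" "b < n"
  shows "i * n + a < j * n + b \<longleftrightarrow> i < j \<or> i = j \<and> a < b"
proof -
  have *: "i * n + a < j * n + b" if "i < j" "0 \<le> a" "a < n" "0 \<le> b" "b < n" for i j a b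
  proof -
    have "(i + 1) * n \<le> j * n" using that by (intro mult_right_mono) auto
    then show ?thesis using that by (simp add: algebra_simps)
  qed
  consider "i < j" | "i = j" | "j < i" by linarith
  then show ?thesis
    by cases (use *[of i j a b] *[of j i b a] assms in auto)
qed

text \<open>
  The pair \<open>(a, j)\<close> stands for the factor \<open>1 + q\<^bsup>j - 1\<^esup> \<pi>\<^sub>a\<close>. On pairs with \<open>0 < a < n\<close> the row key
  orders by increasing \<open>j\<close>, then decreasing \<open>a\<close>, and the diagonal key by increasing \<open>j - a\<close>, then
  increasing \<open>a\<close>. The degree drop is the exponent of the inverse of \<open>q\<close> in a product of factors.
\<close>
definition row_key :: "nat \<Rightarrow> int \<times> int \<Rightarrow> int" where
  "row_key n p = snd p * int n - fst p"

definition diag_key :: "nat \<Rightarrow> int \<times> int \<Rightarrow> int" where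
  "diag_key n p = (snd p - fst p) * int n + fst p"

text \<open>For letters at least \<open>1\<close>, \<open>j \<le> a\<close> is automatic when
  \<open>j \<le> 0\<close>, so this is exactly the bound on compatible sequences.\<close>

definition box :: "nat \<Rightarrow> (int \<times> int) set" where
  "box n = {(a, j). 1 \<le> a \<and> a < int n \<and> j \<le> a}"

definition degree_drop :: "(int \<times> int) list \<Rightarrow> int" where
  "degree_drop L = (\<Sum>p\<leftarrow>L. 1 - snd p)"

definition biwords :: "(int \<times> int \<Rightarrow> int) \<Rightarrow> nat \<Rightarrow> int perm \<Rightarrow> (int \<times> int) list set" where
  "biwords key n w = {L. sorted_wrt (<) (map key L) \<and> set L \<subseteq> box n \<and> map fst L \<in> hecke n w}"

lemma row_key_less_iff:
  assumes "1 \<le> a" "a < int n" "1 \<le> b" "b < int n"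
  shows "row_key n (a, i) < row_key n (b, j) \<longleftrightarrow> i < j \<or> i = j \<and> b < a"
  \<comment> \<open>\<open>i * int n - a\<close> is \<open>(i - 1) * int n + (int n - a)\<close>,
    whose low digit is in range and decreases in \<open>a\<close>.\<close>
  using lex_less_iff[of "int n - a" "int n" "int n - b" "i - 1" "j - 1"] assms
  by (simp add: row_key_def algebra_simps)

lemma diag_key_less_iff:
  assumes "1 \<le> a" "a < int n" "1 \<le> b" "b < int n"
  shows "diag_key n (a, i) < diag_key n (b, j) \<longleftrightarrow> i - a < j - b \<or> i - a = j - b \<and> a < b"
  using lex_less_iff[of a "int n" b "i - a" "j - b"] assms
  by (simp add: diag_key_def)

lemma inj_on_row_key: "inj_on (row_key n) (box n)"
proof (rule inj_onI, clarify)
  fix a i b j assume *: "(a, i) \<in> box n" "(b, j) \<in> box n" "row_key n (a, i) = row_key n (b, j)"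
  then show "a = b \<and> i = j"
    using row_key_less_iff[of a n b i j] row_key_less_iff[of b n a j i] by (auto simp: box_def)
qed

lemma inj_on_diag_key: "inj_on (diag_key n) (box n)"
proof (rule inj_onI, clarify)
  fix a i b j assume *: "(a, i) \<in> box n" "(b, j) \<in> box n" "diag_key n (a, i) = diag_key n (b, j)"
  then show "a = b \<and> i = j"
    using diag_key_less_iff[of a n b i j] diag_key_less_iff[of b n a j i] by (auto simp: box_def)
qed

text \<open>Here the opposite tie-breaks matter. If \<open>fst p = fst r + 1\<close>, both sides say
  \<open>snd p \<le> snd r\<close>; if \<open>fst r = fst p + 1\<close>, both say
  \<open>snd p < snd r\<close>.\<close>

lemma row_key_less_iff_diag_key_less:
  assumes "p \<in> box n" "r \<in> box n" "fst p = fst r + 1 \<or> fst r = fst p + 1"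
  shows "row_key n p < row_key n r \<longleftrightarrow> diag_key n p < diag_key n r"
  using assms row_key_less_iff[of "fst p" n "fst r" "snd p" "snd r"]
    diag_key_less_iff[of "fst p" n "fst r" "snd p" "snd r"]
  by (auto simp: box_def)

section \<open>Re-sorting from one reading to the other\<close>

lemma hecke_cong:
  assumes "a \<in> hecke n w" "set b = set a" "length b = length a"
    and "prod_list (map (\<lambda>i. idc_basis (simple i)) b) = prod_list (map (\<lambda>i. idc_basis (simple i)) a)"
  shows "b \<in> hecke n w"
  using assms by (simp add: hecke_def)

text \<open>Letters whose generators do not commute differ by one. On such pairs the keys agree, so
  sorting by the new key leaves the product unchanged.\<close>

lemma sort_key_biwords:
  assumes L: "L \<in> biwords k n w" and l: "inj_on l (box n)"
    and kl: "\<And>p r. p \<in> box n \<Longrightarrow> r \<in> box n \<Longrightarrow> fst p = fst r + 1 \<or> fst r = fst p + 1 \<Longrightarrow>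
      k p < k r \<longleftrightarrow> l p < l r"
  shows "sort_key l L \<in> biwords l n w"
proof -
  have sub: "set L \<subseteq> box n" and sorted: "sorted_wrt (<) (map k L)" and hecke: "map fst L \<in> hecke n w"
    using L by (auto simp: biwords_def)
  have "distinct L" using sorted by (simp add: strict_sorted_iff distinct_map)
  then have sorted': "sorted_wrt (<) (map l (sort_key l L))"
    using inj_on_subset[OF l sub] by (simp add: strict_sorted_iff distinct_map)
  let ?f = "\<lambda>p. idc_basis (simple (fst p))"
  have "prod_list (map ?f L) = prod_list (map ?f (sort_key l L))"
    using sorted sorted'
  proof (rule prod_list_eq_of_commuting)
    fix p r assume "p \<in> set L" "r \<in> set L" "?f p * ?f r \<noteq> ?f r * ?f p"
    then show "k p < k r \<longleftrightarrow> l p < l r"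
      using sub idc_basis_simple_commute by (intro kl) blast+
  qed simp
  then have "map fst (sort_key l L) \<in> hecke n w"
    by (intro hecke_cong[OF hecke]) (simp_all add: comp_def)
  with sub sorted' show ?thesis by (simp add: biwords_def)
qed

lemma sort_key_sort_key_biwords:
  assumes "L \<in> biwords k n w" "inj_on k (box n)"
  shows "sort_key k (sort_key l L) = L"
proof (rule sort_key_inj_key_eq)
  show "inj_on k (set (sort_key l L))"
    using assms by (simp add: biwords_def inj_on_subset)
  show "sorted (map k L)"
    using assms by (simp add: biwords_def strict_sorted_iff)
qed simp

lemma degree_drop_sort_key [simp]: "degree_drop (sort_key l L) = degree_drop L"
  by (simp add: degree_drop_def flip: sum_mset_sum_list)

text \<open>Sorting by the other key is undone by sorting back, and it only permutes the list, which
  keeps length and degree drop.\<close>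

lemma sum_biwords_row_eq_diag:
  "(\<Sum>L | L \<in> biwords (row_key n) n w \<and> degree_drop L = k. g (length L)) =
   (\<Sum>L | L \<in> biwords (diag_key n) n w \<and> degree_drop L = k. g (length L))"
proof (rule sum.reindex_bij_witness[where i = "sort_key (row_key n)" and j = "sort_key (diag_key n)"])
  fix L
  assume L: "L \<in> {L. L \<in> biwords (row_key n) n w \<and> degree_drop L = k}"
  then show "sort_key (row_key n) (sort_key (diag_key n) L) = L"
    using sort_key_sort_key_biwords inj_on_row_key by blast
  have "sort_key (diag_key n) L \<in> biwords (diag_key n) n w"
    using L row_key_less_iff_diag_key_less
    by (intro sort_key_biwords[where k = "row_key n"] inj_on_diag_key) auto
  then show "sort_key (diag_key n) L \<in> {L. L \<in> biwords (diag_key n) n w \<and> degree_drop L = k}"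
    using L by simp
next
  fix L
  assume L: "L \<in> {L. L \<in> biwords (diag_key n) n w \<and> degree_drop L = k}"
  then show "sort_key (diag_key n) (sort_key (row_key n) L) = L"
    using sort_key_sort_key_biwords inj_on_diag_key by blast
  have "sort_key (row_key n) L \<in> biwords (row_key n) n w"
    using L row_key_less_iff_diag_key_less
    by (intro sort_key_biwords[where k = "diag_key n"] inj_on_row_key) auto
  then show "sort_key (row_key n) L \<in> {L. L \<in> biwords (row_key n) n w \<and> degree_drop L = k}"
    using L by simp
qed simp

section \<open>Finiteness in bounded degree\<close>

text \<open>Pairs of the box with nonpositive second entry only raise the degree drop. The finitely
  many others, each occurring at most once, lower it by at most \<open>C\<close> in all. So a bound
  on the drop bounds every second entry from below.\<close>

lemma finite_degree_drop_le:
  "finite {L. distinct L \<and> set L \<subseteq> box n \<and> degree_drop L \<le> N}"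
proof -
  define f where "f = (\<lambda>p :: int \<times> int. snd p - 1)"
  define P where "P = {1..<int n} \<times> {1..<int n}"
  define C where "C = sum f P"
  have finP: "finite P" by (simp add: P_def)
  have "set L \<subseteq> {1..<int n} \<times> {1 - N - C..int n}"
    if L: "distinct L" "set L \<subseteq> box n" "degree_drop L \<le> N" for L
  proof
    fix p assume p: "p \<in> set L"
    have "sum f (set L) = (\<Sum>p\<leftarrow>L. f p)" using L(1) by (simp add: sum_list_distinct_conv_sum_set)
    also have "\<dots> = - degree_drop L"
      by (simp add: degree_drop_def f_def uminus_sum_list_map comp_def)
    finally have "- N \<le> sum f (set L)" using L(3) by simp
    also have "\<dots> = f p + sum f (set L - {p})" using p by (simp add: sum.remove)
    also have "sum f (set L - {p}) = sum f ((set L - {p}) \<inter> P) + sum f ((set L - {p}) - P)"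
      by (simp add: sum.Int_Diff[symmetric])
    also have "sum f ((set L - {p}) - P) \<le> 0"
      using L(2) by (intro sum_nonpos) (auto simp: f_def P_def box_def)
    also have "sum f ((set L - {p}) \<inter> P) \<le> C"
      unfolding C_def by (intro sum_mono2 finP) (auto simp: f_def P_def)
    finally have "1 - N - C \<le> snd p" by (simp add: f_def)
    then show "p \<in> {1..<int n} \<times> {1 - N - C..int n}"
      using p L(2) by (cases p) (auto simp: box_def)
  qed
  then have "{L. distinct L \<and> set L \<subseteq> box n \<and> degree_drop L \<le> N} \<subseteq>
      {L. set L \<subseteq> {1..<int n} \<times> {1 - N - C..int n} \<and> distinct L}" by blast
  then show ?thesis by (rule finite_subset) (intro finite_subset_distinct, simp)
qed

lemma finite_biwords: "finite {L \<in> biwords key n w. degree_drop L \<le> N}"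
  by (rule finite_subset[OF _ finite_degree_drop_le[of n N]])
    (auto simp: biwords_def strict_sorted_iff distinct_map)


section \<open>The row reading\<close>

lemma support_subset:
  assumes "w \<in> simple_subgroup I"
  shows "support w \<subseteq> I"
proof -
  obtain a where a: "set a \<subseteq> I" "w = prod_list (map simple a)"
    using assms by (auto simp: simple_subgroup_def)
  \<comment> \<open>A generator \<open>simple i\<close> with \<open>i \<noteq> j\<close> moves
    nothing across the cut between \<open>j\<close> and \<open>j + 1\<close>.\<close>
  have "prod_list (map simple a) \<langle>$\<rangle> x \<le> j \<longleftrightarrow> x \<le> j" if "j \<notin> set a" for j x
    using that by (induction a) (auto simp: apply_times apply_simple split: if_splits)
  then show ?thesis using a by (force simp: support_def not_le[symmetric])
qed

text \<open>\<open>hecke\<close> bounds letters only from above; positivity comes from every letter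
  lying in \<open>support w\<close>.\<close>

lemma hecke_letters:
  assumes "a \<in> hecke n w" "w \<in> simple_subgroup {1..<int n}"
  shows "set a \<subseteq> {1..<int n}"
  using hecke_support[OF assms(1)] support_subset[OF assms(2)] by blast

text \<open>Between neighbours the row key rises exactly if \<open>js\<close> rises, or stays while
  the letter falls; so a letter that does not fall forces a strict rise.\<close>

lemma compatible_iff:
  assumes "set a \<subseteq> {1..<int n}" and len: "length js = length a"
  shows "js \<in> compatible a \<longleftrightarrow>
    sorted_wrt (<) (map (row_key n) (zip a js)) \<and> set (zip a js) \<subseteq> box n"
proof -
  have a: "1 \<le> a ! k" "a ! k < int n" if "k < length a" for k
    using assms(1) that nth_mem by fastforce+
  have "sorted_wrt (<) (map (row_key n) (zip a js)) \<longleftrightarrow>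
      (\<forall>k. Suc k < length a \<longrightarrow> js ! k < js ! Suc k \<or> js ! k = js ! Suc k \<and> a ! Suc k < a ! k)"
    using a len by (auto simp: sorted_wrt_iff_nth_Suc_transp row_key_less_iff)
  also have "\<dots> \<longleftrightarrow> sorted js \<and>
      (\<forall>k. Suc k < length a \<longrightarrow> a ! k \<le> a ! Suc k \<longrightarrow> js ! k < js ! Suc k)"
    using len by (auto simp: sorted_iff_nth_Suc)
  finally have 1: "sorted_wrt (<) (map (row_key n) (zip a js)) \<longleftrightarrow> \<dots>" .
  have "set (zip a js) \<subseteq> box n \<longleftrightarrow> (\<forall>k < length a. 0 < js ! k \<longrightarrow> js ! k \<le> a ! k)"
    using a len by (fastforce simp: box_def set_zip)
  with 1 len show ?thesis by (auto simp: compatible_def)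
qed

lemma zip_mem_biwords_row:
  assumes "a \<in> hecke n w" "js \<in> compatible a" "w \<in> simple_subgroup {1..<int n}"
  shows "zip a js \<in> biwords (row_key n) n w"
proof -
  have "length js = length a" using assms(2) by (simp add: compatible_def)
  then show ?thesis
    using assms compatible_iff[OF hecke_letters[OF assms(1,3)]] by (simp add: biwords_def)
qed

lemma biwords_row_compatible:
  assumes "L \<in> biwords (row_key n) n w" "w \<in> simple_subgroup {1..<int n}"
  shows "map snd L \<in> compatible (map fst L)"
  using assms hecke_letters[of "map fst L" n w]
  by (subst compatible_iff) (auto simp: biwords_def zip_map_fst_snd)

lemma backstable_grothendieck_eq:
  assumes "w \<in> simple_subgroup {1..<int n}"
  shows "backstable_grothendieck n w m =
    (\<Sum>L | L \<in> biwords (row_key n) n w \<and> mset (map snd L) = m. \<beta> ^ (length L - cox_length w))"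
  unfolding backstable_grothendieck_def
proof (rule sum.reindex_bij_witness[where i = "\<lambda>L. (map fst L, map snd L)" and j = "\<lambda>(a, js). zip a js"])
  fix x assume x: "x \<in> {(a, js). a \<in> hecke n w \<and> js \<in> compatible a \<and> mset js = m}"
  obtain a js where [simp]: "x = (a, js)" by (cases x)
  from x have *: "a \<in> hecke n w" "js \<in> compatible a" "mset js = m" by auto
  then have len: "length js = length a" by (simp add: compatible_def)
  then show "(map fst (case x of (a, js) \<Rightarrow> zip a js), map snd (case x of (a, js) \<Rightarrow> zip a js)) = x"
    by simp
  show "(case x of (a, js) \<Rightarrow> zip a js) \<in> {L. L \<in> biwords (row_key n) n w \<and> mset (map snd L) = m}"
    using * len zip_mem_biwords_row[OF *(1,2) assms] by (simp del: mset_map)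
  show "\<beta> ^ (length (case x of (a, js) \<Rightarrow> zip a js) - cox_length w) =
      (case x of (a, js) \<Rightarrow> \<beta> ^ (length js - cox_length w))"
    using len by simp
next
  fix L assume "L \<in> {L. L \<in> biwords (row_key n) n w \<and> mset (map snd L) = m}"
  then show "(map fst L, map snd L) \<in> {(a, js). a \<in> hecke n w \<and> js \<in> compatible a \<and> mset js = m}"
    using biwords_row_compatible[OF _ assms] by (auto simp: biwords_def)
qed (simp add: zip_map_fst_snd)

text \<open>The multiset \<open>m\<close> determines the degree drop: in that degree the sum is the
  whole coefficient at \<open>m\<close>, in all others it is empty.\<close>

lemma principal_term_nth:
  assumes "w \<in> simple_subgroup {1..<int n}"
  shows "fls_nth (principal_term (backstable_grothendieck n w) m) k =
    (\<Sum>L | L \<in> biwords (row_key n) n w \<and> mset (map snd L) = m \<and> degree_drop L = k.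
      \<beta> ^ (length L - cox_length w))"
proof -
  have drop: "degree_drop L = - (\<Sum>i\<in>#m. i - 1)" if "mset (map snd L) = m" for L
    unfolding that[symmetric] by (induction L) (simp_all add: degree_drop_def)
  show ?thesis
  proof (cases "k = - (\<Sum>i\<in>#m. i - 1)")
    case True
    then have "{L. L \<in> biwords (row_key n) n w \<and> mset (map snd L) = m \<and> degree_drop L = k} =
        {L. L \<in> biwords (row_key n) n w \<and> mset (map snd L) = m}" using drop by blast
    then show ?thesis using True
      by (simp add: principal_term_def prod_mset_q_pow q_pow_nth backstable_grothendieck_eq[OF assms])
  next
    case False
    then have "{L. L \<in> biwords (row_key n) n w \<and> mset (map snd L) = m \<and> degree_drop L = k} = {}"
      using drop by blast
    then show ?thesis using False
      by (simp only: sum.empty) (simp add: principal_term_def prod_mset_q_pow q_pow_nth)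
  qed
qed


section \<open>The diagonal reading\<close>

text \<open>The diagonal order in the coordinates \<open>(a, i)\<close> with
  \<open>i = j - a - 1\<close>.\<close>

definition precedes :: "int \<times> int \<Rightarrow> int \<times> int \<Rightarrow> bool" where
  "precedes p r \<longleftrightarrow> snd p < snd r \<or> snd p = snd r \<and> fst p < fst r"

text \<open>The bound \<open>j \<le> a\<close> of the box becomes \<open>i < 0\<close>, that is
  \<open>m = 0\<close>; other bounds arise in the recursion on the last entry.\<close>

definition below_seqs :: "int list \<Rightarrow> int \<Rightarrow> int \<Rightarrow> int list set" where
  "below_seqs a m s = {is. length is = length a \<and> sorted_wrt precedes (zip a is) \<and>
     set is \<subseteq> {..<m} \<and> sum_list is = s}"

lemma sum_list_le_elem:
  fixes xs :: "int list"
  assumes "x \<in> set xs" "\<forall>x\<in>set xs. x \<le> 0"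
  shows "sum_list xs \<le> x"
  using assms
proof (induction xs)
  case (Cons y xs)
  moreover have "sum_list xs \<le> 0" using Cons.prems(2) by (simp add: sum_list_nonpos)
  ultimately show ?case by auto
qed simp

lemma below_seqs_shift:
  "card (below_seqs a m s) = card (below_seqs a (m + 1) (s + int (length a)))"
proof (rule bij_betw_same_card)
  have *: "map (\<lambda>i. i + c) is \<in> below_seqs a (m + c) (s + c * int (length a))"
    if "is \<in> below_seqs a m s" for "is" c m s
  proof -
    have "zip a (map (\<lambda>i. i + c) is) = map (\<lambda>p. (fst p, snd p + c)) (zip a is)"
      by (simp add: zip_map2 case_prod_beta)
    moreover have "precedes (fst p, snd p + c) (fst r, snd r + c) \<longleftrightarrow> precedes p r" for p r
      by (simp add: precedes_def)
    ultimately show ?thesis using that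
      by (auto simp: below_seqs_def sorted_wrt_map sum_list_addf sum_list_triv)
  qed
  show "bij_betw (map (\<lambda>i. i + 1)) (below_seqs a m s) (below_seqs a (m + 1) (s + int (length a)))"
    by (rule bij_betw_byWitness[where f' = "map (\<lambda>i. i + - 1)"])
      (use *[of _ _ _ 1] *[of _ "m + 1" "s + int (length a)" "-1"] in \<open>auto simp: comp_def\<close>)
qed

lemma finite_below_seqs_0: "finite (below_seqs a 0 s)"
proof (rule finite_subset)
  show "below_seqs a 0 s \<subseteq> {is. set is \<subseteq> {s..0} \<and> length is = length a}"
    using sum_list_le_elem by (fastforce simp: below_seqs_def)
qed (simp add: finite_lists_length_eq)

lemma sorted_wrt_precedes_snoc:
  "sorted_wrt precedes (zs @ [p]) \<longleftrightarrow> sorted_wrt precedes zs \<and> (zs = [] \<or> precedes (last zs) p)"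
proof (cases zs rule: rev_cases)
  case (snoc ys z)
  then have "precedes x p" if "precedes x z" "precedes z p" for x
    using that by (auto simp: precedes_def)
  with snoc show ?thesis by (simp add: sorted_wrt_append) blast
qed simp

text \<open>Either the last entry is less than \<open>m\<close>, or it equals \<open>m\<close> and
  is removed. In the latter case the entry before it may also be \<open>m\<close> if the word
  ascends there, and must be smaller otherwise; \<open>m'\<close> records this.\<close>

lemma below_seqs_append:
  assumes "m' = (if a = [] \<or> last a < x then m + 1 else m)"
  shows "below_seqs (a @ [x]) (m + 1) s =
    below_seqs (a @ [x]) m s \<union> (\<lambda>is. is @ [m]) ` below_seqs a m' (s - m)"
proof -
  have snoc_eq: "is @ [y] \<in> below_seqs (a @ [x]) M s \<longleftrightarrow> length is = length a \<and>
      sorted_wrt precedes (zip a is @ [(x, y)]) \<and> set is \<subseteq> {..<M} \<and> y < M \<and> sum_list is = s - y"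
    for "is" y M by (auto simp: below_seqs_def)
  \<comment> \<open>The last entry is the largest, so an upper bound on it bounds the whole
    sequence.\<close>
  have le: "set is \<subseteq> {..y}" if "length is = length a" "sorted_wrt precedes (zip a is @ [(x, y)])" for "is" y
    using that by (force simp: sorted_wrt_append precedes_def in_set_conv_nth set_zip)
  have key: "sorted_wrt precedes (zip a is @ [(x, m)]) \<longleftrightarrow>
      sorted_wrt precedes (zip a is) \<and> set is \<subseteq> {..<m'}" if len: "length is = length a" for "is"
  proof (cases a rule: rev_cases)
    case Nil
    with len show ?thesis by simp
  next
    case (snoc b y)
    with len obtain js i where "is": "is = js @ [i]" "length js = length b"
      by (cases "is" rule: rev_cases) auto
    have zip: "zip a is = zip b js @ [(y, i)]" by (simp add: snoc "is")
    have "set js \<subseteq> {..i}" if "sorted_wrt precedes (zip a is)"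
      using that "is"(2) by (force simp: zip sorted_wrt_append precedes_def in_set_conv_nth set_zip)
    then show ?thesis
      by (subst sorted_wrt_precedes_snoc) (force simp: zip "is" assms snoc precedes_def)
  qed
  have "is \<in> below_seqs (a @ [x]) (m + 1) s \<longleftrightarrow>
     is \<in> below_seqs (a @ [x]) m s \<or> is \<in> (\<lambda>is. is @ [m]) ` below_seqs a m' (s - m)" for "is"
  proof (cases "is" rule: rev_cases)
    case Nil
    then show ?thesis by (auto simp: below_seqs_def)
  next
    case (snoc js y)
    have R: "is \<in> (\<lambda>is. is @ [m]) ` below_seqs a m' (s - m) \<longleftrightarrow> y = m \<and> length js = length a \<and>
        sorted_wrt precedes (zip a js @ [(x, m)]) \<and> sum_list js = s - m"
      using key[of js] by (auto simp: snoc below_seqs_def)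
    have sub: "set js \<subseteq> {..<M}"
      if "length js = length a" "sorted_wrt precedes (zip a js @ [(x, y)])" "y < M" for M
      using le[OF that(1,2)] that(3) by auto
    show ?thesis
    proof (cases "y = m")
      case True
      then show ?thesis unfolding R unfolding snoc snoc_eq using sub[of "m + 1"] by simp blast
    next
      case False
      then have "y < m + 1 \<longleftrightarrow> y < m" by linarith
      with False show ?thesis unfolding R unfolding snoc snoc_eq using sub[of m] sub[of "m + 1"] by blast
    qed
  qed
  then show ?thesis by blast
qed

text \<open>
  Split by whether the last entry is \<open>-1\<close>: if so, drop it, and otherwise add one to all entries.
\<close>
lemma card_below_seqs_append:
  fixes a :: "int list" and x s :: int
  defines "e \<equiv> (if a = [] \<or> last a < x then 0 else int (length a))"
  shows "card (below_seqs (a @ [x]) 0 s) =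
    card (below_seqs (a @ [x]) 0 (s + int (length a) + 1)) + card (below_seqs a 0 (s + 1 + e))"
proof -
  \<comment> \<open>This is \<open>m'\<close> for \<open>m = -1\<close>. Where it is
    \<open>-1\<close>, raising the bound to \<open>0\<close> adds one to each of the
    \<open>length a\<close> entries, which gives \<open>e\<close>.\<close>
  let ?m = "if a = [] \<or> last a < x then 0 else -1 :: int"
  have eq: "below_seqs (a @ [x]) 0 s =
      below_seqs (a @ [x]) (-1) s \<union> (\<lambda>is. is @ [-1]) ` below_seqs a ?m (s + 1)"
    using below_seqs_append[of ?m a x "-1" s] by simp
  have "finite (below_seqs (a @ [x]) (-1) s) \<and> finite ((\<lambda>is. is @ [-1]) ` below_seqs a ?m (s + 1))"
    using finite_below_seqs_0[of "a @ [x]" s] unfolding eq finite_Un .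
  moreover have "below_seqs (a @ [x]) (-1) s \<inter> (\<lambda>is. is @ [-1]) ` below_seqs a ?m (s + 1) = {}"
  proof -
    have "is @ [-1] \<notin> below_seqs (a @ [x]) (-1) s" for "is" by (simp add: below_seqs_def)
    then show ?thesis by blast
  qed
  ultimately have "card (below_seqs (a @ [x]) 0 s) = card (below_seqs (a @ [x]) (-1) s) +
      card ((\<lambda>is. is @ [-1]) ` below_seqs a ?m (s + 1))"
    unfolding eq by (intro card_Un_disjoint) simp_all
  also have "card ((\<lambda>is. is @ [-1]) ` below_seqs a ?m (s + 1)) = card (below_seqs a ?m (s + 1))"
    by (intro card_image) (simp add: inj_on_def)
  also have "\<dots> = card (below_seqs a 0 (s + 1 + e))"
    using below_seqs_shift[of a "-1" "s + 1"] by (simp add: e_def)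
  also have "card (below_seqs (a @ [x]) (-1) s) = card (below_seqs (a @ [x]) 0 (s + int (length a) + 1))"
    using below_seqs_shift[of "a @ [x]" "-1" s] by (simp add: algebra_simps)
  finally show ?thesis .
qed

text \<open>For \<open>a = []\<close> the added \<open>length a\<close> is \<open>0\<close>, so the
  case condition can be that of \<open>card_below_seqs_append\<close>.\<close>

lemma comaj_append:
  "comaj (a @ [x]) = comaj a + (if a = [] \<or> last a < x then length a else 0)"
proof -
  have "{i. 1 \<le> i \<and> i < length (a @ [x]) \<and> (a @ [x]) ! (i - 1) < (a @ [x]) ! i} =
      {i. 1 \<le> i \<and> i < length a \<and> a ! (i - 1) < a ! i} \<union>
      (if a \<noteq> [] \<and> last a < x then {length a} else {})"
    by (cases a rule: rev_cases) (auto simp: nth_append less_Suc_eq)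
  moreover have "finite {i. 1 \<le> i \<and> i < length a \<and> a ! (i - 1) < a ! i}" by simp
  ultimately show ?thesis unfolding comaj_def by (subst sum.union_disjoint[symmetric] | auto)+
qed

section \<open>The generating function for a fixed word\<close>

text \<open>The sum of \<open>q\<close> to the power \<open>sum_list is\<close> over the sequences
  below \<open>0\<close>; the index \<open>k\<close> counts powers of the inverse of
  \<open>q\<close>, hence the sign.\<close>

definition below_series :: "int list \<Rightarrow> int poly fls" where
  "below_series a = Abs_fls (\<lambda>k. of_nat (card (below_seqs a 0 (- k))))"

lemma below_series_nth: "fls_nth (below_series a) k = of_nat (card (below_seqs a 0 (- k)))"
proof -
  have "below_seqs a 0 (- k) = {}" if "k < 0" for k
    using that sum_list_nonpos[of "_ :: int list"] by (force simp: below_seqs_def)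
  then show ?thesis unfolding below_series_def
    by (intro nth_Abs_fls_lower_bound[of 0]) simp
qed

text \<open>With \<open>p = length a\<close>, appending a letter divides the series by
  \<open>q^(p+1) - 1\<close> and, at an ascent, multiplies it by \<open>q^p\<close>. The ascent
  positions add up to \<open>comaj\<close>.\<close>

lemma below_series_times_q_factorial:
  "(\<Prod>k=1..length a. (q_pow (int k) - 1)) * below_series a = q_pow (int (comaj a))"
proof (induction a rule: rev_induct)
  case Nil
  have "below_seqs [] 0 (- k) = (if k = 0 then {[]} else {})" for k by (auto simp: below_seqs_def)
  then show ?case by (intro fls_eqI) (simp add: below_series_nth comaj_def)
next
  case (snoc x a)
  \<comment> \<open>Complementary to the \<open>e\<close> of \<open>card_below_seqs_append\<close>:
    the two add up to \<open>length a\<close>.\<close>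
  let ?e = "if a = [] \<or> last a < x then int (length a) else 0"
  have "(q_pow (int (Suc (length a))) - 1) * below_series (a @ [x]) = q_pow ?e * below_series a"
  proof (rule fls_eqI)
    fix k
    let ?s = "- (k + int (Suc (length a)))"
    have "card (below_seqs (a @ [x]) 0 ?s) =
        card (below_seqs (a @ [x]) 0 (- k)) + card (below_seqs a 0 (- (k + ?e)))"
    proof -
      have "?s + int (length a) + 1 = - k"
        "?s + 1 + (if a = [] \<or> last a < x then 0 else int (length a)) = - (k + ?e)" by auto
      then show ?thesis using card_below_seqs_append[of a x ?s] by (simp only:)
    qed
    then show "fls_nth ((q_pow (int (Suc (length a))) - 1) * below_series (a @ [x])) k =
        fls_nth (q_pow ?e * below_series a) k"
      by (simp only: left_diff_distrib fls_minus_nth q_pow_times_nth below_series_nth mult_1) simp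
  qed
  then have "(\<Prod>k=1..length (a @ [x]). (q_pow (int k) - 1)) * below_series (a @ [x]) =
      q_pow ?e * ((\<Prod>k=1..length a. (q_pow (int k) - 1)) * below_series a)"
    by (simp add: prod.cl_ivl_Suc mult_ac del: of_nat_Suc)
  also have "\<dots> = q_pow (int (comaj (a @ [x])))"
    unfolding snoc.IH by (auto simp: comaj_append add.commute simp flip: q_pow_add)
  finally show ?case .
qed

lemma below_series_eq: "below_series a = inv_q_factorial (length a) * q_pow (int (comaj a))"
proof -
  have "below_series a = ((\<Prod>k=1..length a. (q_pow (int k) - 1)) * inv_q_factorial (length a)) * below_series a"
    by (simp only: inv_q_factorial mult_1)
  also have "\<dots> = inv_q_factorial (length a) * ((\<Prod>k=1..length a. (q_pow (int k) - 1)) * below_series a)"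
    by (simp only: mult_ac)
  finally show ?thesis by (simp only: below_series_times_q_factorial)
qed

text \<open>Put \<open>i = j - a - 1\<close>: then \<open>j \<le> a\<close> becomes
  \<open>i < 0\<close>, the diagonal order becomes \<open>precedes\<close>, and the terms
  \<open>1 - j\<close> of the degree drop become \<open>- i - a\<close>.\<close>

lemma card_biwords_diag:
  assumes a: "a \<in> hecke n w" and w: "w \<in> simple_subgroup {1..<int n}"
  shows "card {L. L \<in> biwords (diag_key n) n w \<and> map fst L = a \<and> degree_drop L = k} =
    card (below_seqs a 0 (- k - sum_list a))"
proof (rule bij_betw_same_card[symmetric])
  let ?f = "\<lambda>is. map (\<lambda>p. (fst p, snd p + fst p + 1)) (zip a is)"
  let ?g = "map (\<lambda>p. snd p - fst p - 1)"
  have letters: "1 \<le> fst p" "fst p < int n" if "p \<in> set (zip a is)" for p and "is" :: "int list"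
  proof -
    have "fst p \<in> set a" using that by (metis prod.collapse set_zip_leftD)
    then show "1 \<le> fst p" "fst p < int n" using hecke_letters[OF a w] by auto
  qed
  have sum_zip: "(\<Sum>p\<leftarrow>zip a is. h (fst p)) = (\<Sum>x\<leftarrow>a. h x)" "(\<Sum>p\<leftarrow>zip a is. h (snd p)) = (\<Sum>x\<leftarrow>is. h x)"
    if "length is = length a" for "is" and h :: "int \<Rightarrow> int"
  proof -
    have "(\<Sum>p\<leftarrow>zip a is. h (fst p)) = sum_list (map h (map fst (zip a is)))"
      "(\<Sum>p\<leftarrow>zip a is. h (snd p)) = sum_list (map h (map snd (zip a is)))" by (simp_all add: comp_def)
    then show "(\<Sum>p\<leftarrow>zip a is. h (fst p)) = (\<Sum>x\<leftarrow>a. h x)" "(\<Sum>p\<leftarrow>zip a is. h (snd p)) = (\<Sum>x\<leftarrow>is. h x)"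
      using that by simp_all
  qed
  have iff: "?f is \<in> {L. L \<in> biwords (diag_key n) n w \<and> map fst L = a \<and> degree_drop L = k} \<longleftrightarrow>
      is \<in> below_seqs a 0 (- k - sum_list a)" if len: "length is = length a" for "is"
  proof -
    let ?less = "\<lambda>p r. diag_key n (fst p, snd p + fst p + 1) < diag_key n (fst r, snd r + fst r + 1)"
    have "?less p r \<longleftrightarrow> precedes p r" if "p \<in> set (zip a is)" "r \<in> set (zip a is)" for p r
      using letters[OF that(1)] letters[OF that(2)] by (auto simp: diag_key_less_iff precedes_def)
    then have "sorted_wrt ?less (zip a is) \<longleftrightarrow> sorted_wrt precedes (zip a is)"
      using sorted_wrt_mono_rel[of "zip a is" ?less precedes]
        sorted_wrt_mono_rel[of "zip a is" precedes ?less] by blast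
    then have "sorted_wrt (<) (map (diag_key n) (?f is)) \<longleftrightarrow> sorted_wrt precedes (zip a is)"
      by (simp add: sorted_wrt_map)
    moreover have "set (?f is) \<subseteq> box n \<longleftrightarrow> set is \<subseteq> {..<0}"
    proof -
      have "set is = snd ` set (zip a is)" using len by (metis list.set_map map_snd_zip)
      moreover have "(fst p, snd p + fst p + 1) \<in> box n \<longleftrightarrow> snd p < 0" if "p \<in> set (zip a is)" for p
        using letters[OF that] by (auto simp: box_def)
      ultimately show ?thesis by (simp add: image_subset_iff)
    qed
    moreover have fst: "map fst (?f is) = a" using len by (simp add: comp_def)
    moreover have "degree_drop (map (\<lambda>p. (fst p, snd p + fst p + 1)) Z) =
        - (\<Sum>p\<leftarrow>Z. snd p) - (\<Sum>p\<leftarrow>Z. fst p)" for Z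
      by (induction Z) (simp_all add: degree_drop_def)
    then have "degree_drop (?f is) = - sum_list is - sum_list a"
      using sum_zip[OF len, of "\<lambda>x. x"] by simp
    ultimately show ?thesis using a len
      unfolding biwords_def below_seqs_def mem_Collect_eq fst by auto
  qed
  have gf: "?g (?f is) = is" if "length is = length a" for "is"
    using that by (simp add: comp_def)
  have fg: "?f (?g L) = L" if "map fst L = a" for L
    using that[symmetric] by (simp add: zip_map_map zip_same_conv_map comp_def)
  show "bij_betw ?f (below_seqs a 0 (- k - sum_list a))
      {L. L \<in> biwords (diag_key n) n w \<and> map fst L = a \<and> degree_drop L = k}"
  proof (rule bij_betw_byWitness[where f' = ?g])
    show "\<forall>is\<in>below_seqs a 0 (- k - sum_list a). ?g (?f is) = is"
      using gf by (simp add: below_seqs_def)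
    show "\<forall>L\<in>{L. L \<in> biwords (diag_key n) n w \<and> map fst L = a \<and> degree_drop L = k}. ?f (?g L) = L"
      using fg by blast
    show "?f ` below_seqs a 0 (- k - sum_list a) \<subseteq>
        {L. L \<in> biwords (diag_key n) n w \<and> map fst L = a \<and> degree_drop L = k}"
    proof (rule image_subsetI)
      fix "is" assume "is": "is \<in> below_seqs a 0 (- k - sum_list a)"
      then have "length is = length a" by (simp add: below_seqs_def)
      from iff[OF this] "is" show "?f is \<in>
        {L. L \<in> biwords (diag_key n) n w \<and> map fst L = a \<and> degree_drop L = k}" by blast
    qed
    show "?g ` {L. L \<in> biwords (diag_key n) n w \<and> map fst L = a \<and> degree_drop L = k} \<subseteq>
        below_seqs a 0 (- k - sum_list a)"
    proof (rule image_subsetI)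
      fix L assume L: "L \<in> {L. L \<in> biwords (diag_key n) n w \<and> map fst L = a \<and> degree_drop L = k}"
      then have "map fst L = a" by blast
      then have len: "length (?g L) = length a" and eq: "?f (?g L) = L" using fg by auto
      show "?g L \<in> below_seqs a 0 (- k - sum_list a)" using iff[OF len] L unfolding eq by blast
    qed
  qed
qed

lemma hecke_term_nth:
  assumes "a \<in> hecke n w" "w \<in> simple_subgroup {1..<int n}"
  shows "fls_nth (fls_const (\<beta> ^ (length a - cox_length w)) * inv_q_factorial (length a) *
      q_pow (sum_list a + int (comaj a))) k =
    (\<Sum>L | L \<in> biwords (diag_key n) n w \<and> map fst L = a \<and> degree_drop L = k.
      \<beta> ^ (length L - cox_length w))"
proof -
  have "fls_const (\<beta> ^ (length a - cox_length w)) * inv_q_factorial (length a) *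
      q_pow (sum_list a + int (comaj a)) =
      fls_const (\<beta> ^ (length a - cox_length w)) * (below_series a * q_pow (sum_list a))"
    by (simp add: below_series_eq q_pow_add mult_ac)
  then have "fls_nth (fls_const (\<beta> ^ (length a - cox_length w)) * inv_q_factorial (length a) *
      q_pow (sum_list a + int (comaj a))) k =
      \<beta> ^ (length a - cox_length w) * of_nat (card (below_seqs a 0 (- k - sum_list a)))"
    by (simp only:) (simp add: below_series_nth)
  also have "\<dots> = (\<Sum>L | L \<in> biwords (diag_key n) n w \<and> map fst L = a \<and> degree_drop L = k.
      \<beta> ^ (length a - cox_length w))"
    by (simp add: card_biwords_diag[OF assms] mult.commute)
  also have "\<dots> = (\<Sum>L | L \<in> biwords (diag_key n) n w \<and> map fst L = a \<and> degree_drop L = k.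
      \<beta> ^ (length L - cox_length w))"
    by (intro sum.cong) auto
  finally show ?thesis .
qed

section \<open>Comparison of the two sums\<close>

theorem theorem3p3:
  fixes n :: nat and w :: "int perm"
  assumes "n \<ge> 1" and "w \<in> simple_subgroup {1..<int n}"
  shows "principal_term (backstable_grothendieck n w) summable_on monomials n \<and>
    ((\<lambda>a. fls_const (\<beta> ^ (length a - cox_length w)) * inv_q_factorial (length a) *
           q_pow (sum_list a + int (comaj a)))
       has_sum principal_specialization n (backstable_grothendieck n w)) (hecke n w)"
proof -
  let ?c = "\<lambda>L :: (int \<times> int) list. \<beta> ^ (length L - cox_length w)"
  obtain S where S: "\<And>k. fls_nth S k = (\<Sum>L | L \<in> biwords (row_key n) n w \<and> degree_drop L = k. ?c L)"
    using ex_fls_nth_eq_sum[OF finite_biwords[of "row_key n" n w], of ?c] by blast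
  \<comment> \<open>Grouping row biwords by the multiset of their second entries gives the
    specialised monomials.\<close>
  have row: "(principal_term (backstable_grothendieck n w) has_sum S) (monomials n)"
  proof (rule has_sum_fls_fibres[OF finite_biwords S])
    show "(\<lambda>L. mset (map snd L)) ` biwords (row_key n) n w \<subseteq> monomials n"
      by (fastforce simp: biwords_def monomials_def box_def)
  qed (rule principal_term_nth[OF assms(2)])
  \<comment> \<open>Re-sorting expresses the same \<open>S\<close> through diagonal biwords, now
    grouped by their words.\<close>
  have "((\<lambda>a. fls_const (\<beta> ^ (length a - cox_length w)) * inv_q_factorial (length a) *
      q_pow (sum_list a + int (comaj a))) has_sum S) (hecke n w)"
  proof (rule has_sum_fls_fibres[OF finite_biwords])
    show "fls_nth S k = (\<Sum>L | L \<in> biwords (diag_key n) n w \<and> degree_drop L = k. ?c L)" for k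
      unfolding S by (rule sum_biwords_row_eq_diag)
    show "map fst ` biwords (diag_key n) n w \<subseteq> hecke n w" by (auto simp: biwords_def)
  qed (rule hecke_term_nth[OF _ assms(2)])
  moreover have "principal_specialization n (backstable_grothendieck n w) = S"
    unfolding principal_specialization_def using row by (rule infsumI)
  ultimately show ?thesis using row by (auto simp: summable_on_def)
qed

end
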